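(* Let $F\in\ell^2(\mathbb Z)$ be supported in $[0,\infty)$ and let $(a,b)$ be its nonlinear Fourier series. Then the layer stripping sequence of $(a,b)$ is $(F_n)_{n\ge0}$, and $(a,b)\in\mathbf H$. Conversely, if $(a,b)\in\mathbf H$, then its layer stripping sequence is square summable and $(a,b)$ is the nonlinear Fourier series of this layer stripping sequence (viewed as a sequence on $\mathbb Z$ supported in $[0,\infty)$).
   Context: $\mathbb T$ is the unit circle, $\mathbb D$ the open unit disc, $\mathbb D^*=\{\overline z^{-1}:z\in\mathbb D\}$, $a^*(z)=\overline{a(\overline z^{-1})}$. $H^2(\mathbb D)$: functions in $L^2(\mathbb T)$ with vanishing negative Fourier coefficients; $H^2(\mathbb D^* )$: $f$ with $f^*\in H^2(\mathbb D)$, and $f(\infty):=\overline{f^*(0)}$. Pairs multiply as $(a,b)(c,d)=(ac-bd^*,ad+bc^* )$, with $y^*=\overline y$ for constants and $(z^k)^*=z^{-k}$. $\mathbf L$: pairs $(a,b)$ of measurable functions on $\mathbb T$ with $aa^*+bb^*=1$ a.e., $a\in H^2(\mathbb D^* )$, $a(\infty)>0$, with metric $\rho((a,b),(c,d))=\|a-c\|_{L^2}+\|b-d\|_{L^2}+|\log a(\infty)-\log c(\infty)|$. $\overline{\mathbf H}$: $(a,b)\in\mathbf L$ with $b\in H^2(\mathbb D)$. $\mathbf H$: $(a,b)\in\overline{\mathbf H}$ such that any inner function $g$ with $a^*g^{-1},bg^{-1}\in H^2(\mathbb D)$ is constant. Nonlinear Fourier series of $F\in\ell^2(\mathbb Z)$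 supported in $[0,\infty)$: the $\rho$-limit in $\mathbf L$ (which exists) of $(a_k,b_k)$, where $(a_0,b_0)=(1+|F_0|^2)^{-1/2}(1,F_0)$ and $(a_k,b_k)=(a_{k-1},b_{k-1})(1+|F_k|^2)^{-1/2}(1,F_kz^k)$. Layer stripping sequence of $(a,b)\in\overline{\mathbf H}$: set $(a_0,b_0)=(a,b)$ and recursively $(a_{n+1}(z),b_{n+1}(z)z)=(1+|F_n|^2)^{-1/2}(1,-F_n)(a_n(z),b_n(z))$, where $F_n\in\mathbb C$ is the unique number for which $(a_{n+1},b_{n+1})\in\overline{\mathbf H}$ (explicitly $F_n=b_n(0)/a_n^*(0)$); the layer stripping sequence is $(F_n)_{n\ge0}$. *)

theory Defs
  imports "HOL-Analysis.Analysis"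
begin

text \<open>Functions on the unit circle T are represented as functions complex \<Rightarrow> complex;
  only their values on T, parametrised as cis t with t in [0, 2 pi], matter.
  All measure-theoretic notions are taken w.r.t. Lebesgue measure in the parameter t.\<close>

type_synonym cfun = "complex \<Rightarrow> complex"
type_synonym cpair = "cfun \<times> cfun"

definition circ :: "real set" where "circ = {0..2*pi}"

text \<open>a^*(z) = conj (a (1 / conj z)); on T this is conj (a z).\<close>
definition star :: "cfun \<Rightarrow> cfun" where
  "star f = (\<lambda>z. cnj (f (1 / cnj z)))"

definition L2T :: "cfun \<Rightarrow> bool" where
  "L2T f \<longleftrightarrow> set_borel_measurable lborel circ (\<lambda>t. f (cis t)) \<and>
     set_integrable lborel circ (\<lambda>t. (cmod (f (cis t)))\<^sup>2)"

definition fourier :: "cfun \<Rightarrow> int \<Rightarrow> complex" where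
  "fourier f k = (1 / (2 * pi)) * (LINT t:circ|lborel. f (cis t) * cis (- (of_int k * t)))"

definition H2D :: "cfun \<Rightarrow> bool" where
  "H2D f \<longleftrightarrow> L2T f \<and> (\<forall>k<0. fourier f k = 0)"

definition H2Dstar :: "cfun \<Rightarrow> bool" where
  "H2Dstar f \<longleftrightarrow> H2D (star f)"

text \<open>f(\<infinity>) := conj (f^*(0)), where f^*(0) is the value at 0 of the holomorphic
  extension of f^* to D, i.e. its 0-th Fourier coefficient.\<close>
definition at_infty :: "cfun \<Rightarrow> complex" where
  "at_infty f = cnj (fourier (star f) 0)"

definition pmult :: "cpair \<Rightarrow> cpair \<Rightarrow> cpair" where
  "pmult p q = (\<lambda>z. fst p z * fst q z - snd p z * star (snd q) z,
                \<lambda>z. fst p z * snd q z + snd p z * star (fst q) z)"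

definition in_L :: "cpair \<Rightarrow> bool" where
  "in_L p \<longleftrightarrow>
     set_borel_measurable lborel circ (\<lambda>t. fst p (cis t)) \<and>
     set_borel_measurable lborel circ (\<lambda>t. snd p (cis t)) \<and>
     (AE t in lborel. t \<in> circ \<longrightarrow>
        fst p (cis t) * star (fst p) (cis t) + snd p (cis t) * star (snd p) (cis t) = 1) \<and>
     H2Dstar (fst p) \<and>
     at_infty (fst p) \<in> \<real> \<and> Re (at_infty (fst p)) > 0"

definition L2dist :: "cfun \<Rightarrow> cfun \<Rightarrow> real" where
  "L2dist f g = sqrt ((1 / (2 * pi)) * (LINT t:circ|lborel. (cmod (f (cis t) - g (cis t)))\<^sup>2))"

definition rho :: "cpair \<Rightarrow> cpair \<Rightarrow> real" where
  "rho p q = L2dist (fst p) (fst q) + L2dist (snd p) (snd q) +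
     \<bar>ln (Re (at_infty (fst p))) - ln (Re (at_infty (fst q)))\<bar>"

definition in_Hbar :: "cpair \<Rightarrow> bool" where
  "in_Hbar p \<longleftrightarrow> in_L p \<and> H2D (snd p)"

text \<open>Inner function (via boundary values): an H^2(D) = H^\<infinity>(D) function with
  unimodular boundary values a.e. on T.\<close>
definition inner_fun :: "cfun \<Rightarrow> bool" where
  "inner_fun g \<longleftrightarrow> H2D g \<and> (AE t in lborel. t \<in> circ \<longrightarrow> cmod (g (cis t)) = 1)"

definition const_on_T :: "cfun \<Rightarrow> bool" where
  "const_on_T g \<longleftrightarrow> (\<exists>c. AE t in lborel. t \<in> circ \<longrightarrow> g (cis t) = c)"

definition in_H :: "cpair \<Rightarrow> bool" where
  "in_H p \<longleftrightarrow> in_Hbar p \<and>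
     (\<forall>g. inner_fun g \<and> H2D (\<lambda>z. star (fst p) z / g z) \<and> H2D (\<lambda>z. snd p z / g z)
          \<longrightarrow> const_on_T g)"

primrec nlfs_partial :: "(int \<Rightarrow> complex) \<Rightarrow> nat \<Rightarrow> cpair" where
  "nlfs_partial F 0 =
     (let c = complex_of_real (1 / sqrt (1 + (cmod (F 0))\<^sup>2)) in (\<lambda>z. c, \<lambda>z. c * F 0))"
| "nlfs_partial F (Suc k) =
     (let c = complex_of_real (1 / sqrt (1 + (cmod (F (int (Suc k))))\<^sup>2)) in
      pmult (nlfs_partial F k) (\<lambda>z. c, \<lambda>z. c * F (int (Suc k)) * z ^ Suc k))"

definition is_NLFS :: "(int \<Rightarrow> complex) \<Rightarrow> cpair \<Rightarrow> bool" where
  "is_NLFS F p \<longleftrightarrow> in_L p \<and> (\<lambda>k. rho (nlfs_partial F k) p) \<longlonglongrightarrow> 0"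

text \<open>Layer stripping: F_n = b_n(0) / a_n^*(0) and
  (a_{n+1}(z), b_{n+1}(z) z) = (1+|F_n|^2)^{-1/2} (1,-F_n)(a_n(z), b_n(z)).\<close>
definition ls_coeff :: "cpair \<Rightarrow> complex" where
  "ls_coeff p = fourier (snd p) 0 / fourier (star (fst p)) 0"

definition ls_step :: "cpair \<Rightarrow> cpair" where
  "ls_step p = (let F = ls_coeff p; c = complex_of_real (1 / sqrt (1 + (cmod F)\<^sup>2));
                    q = pmult (\<lambda>z. c, \<lambda>z. c * (- F)) p
                in (fst q, \<lambda>z. snd q z / z))"

primrec ls_pairs :: "cpair \<Rightarrow> nat \<Rightarrow> cpair" where
  "ls_pairs p 0 = p"
| "ls_pairs p (Suc n) = ls_step (ls_pairs p n)"

definition ls_seq :: "cpair \<Rightarrow> nat \<Rightarrow> complex" where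
  "ls_seq p n = ls_coeff (ls_pairs p n)"

end

theory Submission
  imports Defs "HOL-Probability.Probability_Measure"
begin

text \<open>
  Call the map from \<open>(a, b)\<close> to the product of \<open>(1, F) / sqrt (1 + |F|\<^sup>2)\<close> and \<open>(a, z b)\<close> a layer.
  A layer is a pointwise isometry of \<open>\<complex>\<^sup>2\<close>, it is inverted by layer stripping, and the distance of a pair in
  \<open>\<^bold>L\<close> to \<open>(1, 0)\<close> satisfies \<open>\<parallel>a - 1\<parallel>\<^sup>2 + \<parallel>b\<parallel>\<^sup>2 = 2 - 2 a(\<infinity>)\<close>. Peeling off layers one by one
  therefore turns every distance into a value at infinity. In particular, if \<open>(a\<^sub>n, b\<^sub>n)\<close> are the
  stripped pairs of \<open>(a, b)\<close>, then \<open>(a, b)\<close> is the nonlinear Fourier series of its layer stripping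
  sequence as soon as \<open>a\<^sub>n(\<infinity>) \<rightarrow> 1\<close>.

  For a nonlinear Fourier series \<open>a\<^sub>n(\<infinity>) \<rightarrow> 1\<close> holds. A common inner divisor \<open>g\<close> of \<open>a\<^sup>*\<close> and \<open>b\<close>
  divides all the \<open>a\<^sub>n\<^sup>*\<close>, so \<open>|g(0)| \<ge> a\<^sub>n(\<infinity>)\<close>, hence \<open>|g(0)| = 1\<close> and \<open>g\<close> is constant.
  Conversely, \<open>a\<^sub>n(\<infinity>)\<close> increases to some \<open>l \<le> 1\<close>, which gives square summability and makes the
  partial products a Cauchy sequence. Along a subsequence converging almost everywhere, the tails
  of the product converge to \<open>(X, Y)\<close> with \<open>X(\<infinity>) = l\<close> and with all Fourier coefficients of \<open>Y\<close>
  zero. So \<open>Y = 0\<close>, and \<open>X\<^sup>*\<close> is a common inner divisor of \<open>a\<^sup>*\<close> and \<open>b\<close>; being constant, it is \<open>1\<close>,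
  and \<open>l = 1\<close>.
\<close>

section \<open>Normalised arc length on the circle\<close>

abbreviation circle :: "complex set" where "circle \<equiv> {z. cmod z = 1}"

text \<open>Normalised to total mass 1, so that Fourier coefficients and squared distances become
  plain integrals. Both 0 and 2 pi parametrise the point 1, which affects only a null set.\<close>

definition angle :: "real measure" where
  "angle = density (restrict_space lborel circ) (\<lambda>_. ennreal (1 / (2 * pi)))"

text \<open>The final \<open>\<sigma>\<close>-algebra for \<open>cis\<close>: the definitions only constrain \<open>f \<circ> cis\<close>, and with this choice
  \<open>f\<close> itself is measurable exactly when \<open>f \<circ> cis\<close> is.\<close>

definition circle_algebra :: "complex measure" where
  "circle_algebra = sigma circle {B. B \<subseteq> circle \<and> cis -` B \<inter> circ \<in> sets lborel}"

definition haar :: "complex measure" where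
  "haar = distr angle circle_algebra cis"

lemma circ_borel [measurable, simp]: "circ \<in> sets borel"
  by (simp add: circ_def)

lemma space_angle [simp]: "space angle = circ"
  and sets_angle: "sets angle = sets (restrict_space lborel circ)"
  by (simp_all add: angle_def space_restrict_space)

lemma space_circle_algebra [simp]: "space circle_algebra = circle"
  unfolding circle_algebra_def by (rule space_measure_of) auto

lemma space_haar [simp]: "space haar = circle"
  by (simp add: haar_def)

lemma sets_haarI: "B \<subseteq> circle \<Longrightarrow> cis -` B \<inter> circ \<in> sets lborel \<Longrightarrow> B \<in> sets haar"
  unfolding haar_def sets_distr circle_algebra_def by (subst sets_measure_of) (auto intro!: sigma_sets.Basic)

lemma measurable_angle_iff:
  fixes f :: "real \<Rightarrow> 'b::real_normed_vector"
  shows "f \<in> borel_measurable angle \<longleftrightarrow> set_borel_measurable lborel circ f"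
  unfolding set_borel_measurable_def
  by (subst borel_measurable_restrict_space_iff[symmetric]) (simp_all cong: measurable_cong_sets add: sets_angle)

lemma cis_measurable [measurable]: "cis \<in> angle \<rightarrow>\<^sub>M haar"
  unfolding haar_def measurable_distr_eq2 circle_algebra_def
proof (rule measurable_measure_of)
  fix B assume B: "B \<in> {B. B \<subseteq> circle \<and> cis -` B \<inter> circ \<in> sets lborel}"
  then have "cis -` B \<inter> circ \<in> sets lborel" by auto
  moreover have "cis -` B \<inter> circ \<subseteq> circ" by auto
  ultimately show "cis -` B \<inter> space angle \<in> sets angle"
    unfolding sets_angle by (subst sets_restrict_space_iff) auto
qed (auto)

lemma measurable_haar_iff:
  fixes f :: "complex \<Rightarrow> 'b::real_normed_vector"
  shows "f \<in> borel_measurable haar \<longleftrightarrow> (\<lambda>t. f (cis t)) \<in> borel_measurable angle"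
proof
  assume "f \<in> borel_measurable haar" then show "(\<lambda>t. f (cis t)) \<in> borel_measurable angle"
    by measurable
next
  assume f: "(\<lambda>t. f (cis t)) \<in> borel_measurable angle"
  show "f \<in> borel_measurable haar"
  proof (rule measurableI)
    fix S :: "'b set" assume S: "S \<in> sets borel"
    have "(\<lambda>t. f (cis t)) -` S \<inter> circ \<in> sets (restrict_space lborel circ)"
      using measurable_sets[OF f S] by (simp add: sets_angle)
    then have "(\<lambda>t. f (cis t)) -` S \<inter> circ \<in> sets lborel"
      by (subst (asm) sets_restrict_space_iff) auto
    moreover have "cis -` (f -` S \<inter> circle) \<inter> circ = (\<lambda>t. f (cis t)) -` S \<inter> circ"
      by auto
    ultimately show "f -` S \<inter> space haar \<in> sets haar"
      by (intro sets_haarI) auto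
  qed auto
qed

text \<open>The algebra of \<open>haar\<close> is not the Borel algebra by definition. Continuity of
  \<open>cis\<close> shows that it contains the Borel sets of the circle, so that ordinary functions
  of z are measurable.\<close>

lemma measurable_ident_haar [measurable]: "(\<lambda>z. z) \<in> borel_measurable haar"
proof -
  have "continuous_on UNIV cis" by (intro continuous_intros)
  then have "cis \<in> borel_measurable borel" by (rule borel_measurable_continuous_onI)
  then show ?thesis
    unfolding measurable_haar_iff measurable_angle_iff set_borel_measurable_def by measurable
qed

interpretation angle: prob_space angle
proof
  have "emeasure angle circ = ennreal (1 / (2 * pi)) * emeasure (restrict_space lborel circ) circ"
    unfolding angle_def
    by (subst emeasure_density_const) (simp_all add: sets_restrict_space_iff)
  also have "emeasure (restrict_space lborel circ) circ = ennreal (2 * pi)"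
    by (subst emeasure_restrict_space) (simp_all add: circ_def)
  finally show "emeasure angle (space angle) = 1"
    by (simp flip: ennreal_mult)
qed

interpretation haar: prob_space haar
  unfolding haar_def by (rule angle.prob_space_distr) (use cis_measurable in \<open>simp add: haar_def\<close>)

lemma integrable_angle_iff:
  fixes f :: "real \<Rightarrow> 'b::{banach, second_countable_topology}"
  assumes "f \<in> borel_measurable angle"
  shows "integrable angle f \<longleftrightarrow> set_integrable lborel circ f"
proof -
  have [measurable]: "f \<in> borel_measurable (restrict_space lborel circ)"
    using assms by (simp cong: measurable_cong_sets add: sets_angle)
  have "integrable angle f \<longleftrightarrow> integrable (restrict_space lborel circ) f"
    unfolding angle_def
    \<comment> \<open>Scaling by 2 pi undoes the constant density, which gives the converse
      implication.\<close>
    using integrable_scaleR_right[of "2 * pi" "restrict_space lborel circ" "\<lambda>x. (1 / (2 * pi)) *\<^sub>R f x"]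
    by (subst integrable_density) auto
  then show ?thesis
    by (simp add: integrable_restrict_space set_integrable_def)
qed

lemma integral_angle:
  fixes f :: "real \<Rightarrow> 'b::{banach, second_countable_topology}"
  assumes "f \<in> borel_measurable angle"
  shows "integral\<^sup>L angle f = (1 / (2 * pi)) *\<^sub>R (LINT t:circ|lborel. f t)"
proof -
  have [measurable]: "f \<in> borel_measurable (restrict_space lborel circ)"
    using assms by (simp cong: measurable_cong_sets add: sets_angle)
  have "integral\<^sup>L angle f = (1 / (2 * pi)) *\<^sub>R integral\<^sup>L (restrict_space lborel circ) f"
    unfolding angle_def by (subst integral_density) simp_all
  then show ?thesis
    by (simp add: integral_restrict_space set_lebesgue_integral_def)
qed

lemma integrable_haar_iff:
  fixes f :: "complex \<Rightarrow> 'b::{banach, second_countable_topology}"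
  assumes [measurable]: "f \<in> borel_measurable haar"
  shows "integrable haar f \<longleftrightarrow> set_integrable lborel circ (\<lambda>t. f (cis t))"
proof -
  have "integrable haar f \<longleftrightarrow> integrable angle (\<lambda>t. f (cis t))"
    unfolding haar_def
    by (rule integrable_distr_eq) (use cis_measurable assms in \<open>simp_all add: haar_def\<close>)
  then show ?thesis by (simp add: integrable_angle_iff)
qed

lemma integral_haar_angle:
  fixes f :: "complex \<Rightarrow> 'b::{banach, second_countable_topology}"
  assumes "f \<in> borel_measurable haar"
  shows "integral\<^sup>L haar f = integral\<^sup>L angle (\<lambda>t. f (cis t))"
  unfolding haar_def
  by (rule integral_distr) (use cis_measurable assms in \<open>simp_all add: haar_def\<close>)

lemma integral_haar:
  fixes f :: "complex \<Rightarrow> 'b::{banach, second_countable_topology}"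
  assumes [measurable]: "f \<in> borel_measurable haar"
  shows "integral\<^sup>L haar f = (1 / (2 * pi)) *\<^sub>R (LINT t:circ|lborel. f (cis t))"
proof -
  show ?thesis
    using assms by (simp add: integral_haar_angle integral_angle)
qed

lemma AE_angle_iff:
  "(AE t in angle. P t) \<longleftrightarrow> (AE t in lborel. t \<in> circ \<longrightarrow> P t)"
  unfolding angle_def by (subst AE_density) (simp_all add: AE_restrict_space_iff)

lemma AE_haar_iff:
  assumes "{z \<in> circle. P z} \<in> sets haar"
  shows "(AE z in haar. P z) \<longleftrightarrow> (AE t in lborel. t \<in> circ \<longrightarrow> P (cis t))"
proof -
  have "(AE z in haar. P z) \<longleftrightarrow> (AE t in angle. P (cis t))"
    unfolding haar_def
    by (rule AE_distr_iff) (use cis_measurable assms in \<open>simp_all add: haar_def\<close>)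
  then show ?thesis by (simp add: AE_angle_iff)
qed

lemma measurable_haar:
  fixes f :: "complex \<Rightarrow> 'b::real_normed_vector"
  shows "f \<in> borel_measurable haar \<longleftrightarrow> set_borel_measurable lborel circ (\<lambda>t. f (cis t))"
  by (simp add: measurable_haar_iff measurable_angle_iff)

lemma borel_measurable_powi [measurable]:
  assumes [measurable]: "f \<in> borel_measurable M"
  shows "(\<lambda>z. f z powi k :: complex) \<in> borel_measurable M"
  unfolding power_int_def by measurable

lemma L2T_haar:
  "L2T f \<longleftrightarrow> f \<in> borel_measurable haar \<and> integrable haar (\<lambda>z. (cmod (f z))\<^sup>2)"
  unfolding L2T_def measurable_haar[symmetric] by (auto simp: integrable_haar_iff)

lemma fourier_haar:
  assumes [measurable]: "f \<in> borel_measurable haar"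
  shows "fourier f k = (\<integral>z. f z * z powi (- k) \<partial>haar)"
  unfolding fourier_def
  by (subst integral_haar) (simp_all add: cis_power_int scaleR_conv_of_real)

lemma L2dist_haar:
  assumes [measurable]: "f \<in> borel_measurable haar" "g \<in> borel_measurable haar"
  shows "L2dist f g = sqrt (\<integral>z. (cmod (f z - g z))\<^sup>2 \<partial>haar)"
  unfolding L2dist_def by (subst integral_haar) simp_all

lemma star_circle: "cmod z = 1 \<Longrightarrow> star f z = cnj (f z)"
proof -
  assume "cmod z = 1"
  then have "z * cnj z = 1" "z \<noteq> 0" by (auto simp: complex_norm_square[symmetric])
  then have "1 / cnj z = z" by (simp add: field_simps)
  then show ?thesis by (simp add: star_def)
qed

text \<open>For nonzero k the antiderivative \<open>cis (k * t) / (\<i> * k)\<close> has period 2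
  pi, so its increment over a full turn vanishes.\<close>

lemma integral_powi: "(\<integral>z. z powi k \<partial>haar) = (if k = 0 then 1 else 0)"
proof (cases "k = 0")
  case False
  define F where "F t = cis (of_int k * t) / (\<i> * of_int k)" for t :: real
  have "(F has_vector_derivative cis (of_int k * t)) (at t within S)" for t S
  proof -
    \<comment> \<open>The derivative is computed in a complex variable and then restricted to the
      real line.\<close>
    have "((\<lambda>w. exp (\<i> * (of_int k * w)) / (\<i> * of_int k)) has_field_derivative cis (of_int k * t)) (at (of_real t))"
      using False by (auto intro!: derivative_eq_intros simp: cis_conv_exp mult_ac)
    from has_vector_derivative_real_field[OF this, of S] show ?thesis
      by (simp add: F_def[abs_def] cis_conv_exp)
  qed
  then have "(LINT t:circ|lborel. cis (of_int k * t)) = F (2 * pi) - F 0"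
    unfolding set_lebesgue_integral_def circ_def
    by (intro integral_FTC_Icc) (auto intro!: continuous_intros)
  also have "\<dots> = 0"
    using cis_multiple_2pi[of "of_int k"] by (simp add: F_def mult_ac)
  finally show ?thesis using False
    by (subst integral_haar) (simp_all add: cis_power_int)
qed (use haar.prob_space in simp)

section \<open>Trigonometric polynomials\<close>

text \<open>The parameter K prescribes the admissible frequencies: \<open>UNIV\<close> gives all
  trigonometric polynomials, \<open>{0..}\<close> the analytic ones, and \<open>{..<0}\<close> the
  purely antianalytic ones.\<close>

inductive trig_poly :: "int set \<Rightarrow> cfun \<Rightarrow> bool" for K where
  zero: "trig_poly K (\<lambda>z. 0)"
| monom: "trig_poly K p \<Longrightarrow> k \<in> K \<Longrightarrow> trig_poly K (\<lambda>z. p z + c * z powi k)"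

lemma trig_poly_measurable: "trig_poly K p \<Longrightarrow> p \<in> borel_measurable haar"
  by (induction rule: trig_poly.induct) (auto intro!: borel_measurable_add borel_measurable_times borel_measurable_powi measurable_ident_haar)

lemma norm_powi_circle: "cmod z = 1 \<Longrightarrow> cmod (z powi k) = 1"
  by (simp add: norm_power_int)

lemma trig_poly_bounded: "trig_poly K p \<Longrightarrow> \<exists>C. \<forall>z\<in>circle. cmod (p z) \<le> C"
proof (induction rule: trig_poly.induct)
  case (monom p k c)
  then obtain C where C: "\<And>z. cmod z = 1 \<Longrightarrow> cmod (p z) \<le> C" by auto
  have "cmod (p z + c * z powi k) \<le> C + cmod c" if "cmod z = 1" for z
    by (rule norm_triangle_le) (use C[OF that] norm_powi_circle[OF that] in \<open>simp add: norm_mult\<close>)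
  then show ?case by auto
qed auto

lemma trig_poly_add:
  assumes "trig_poly K p" and q: "trig_poly K q"
  shows "trig_poly K (\<lambda>z. p z + q z)"
  using q
proof (induction rule: trig_poly.induct)
  case (monom q k c)
  from trig_poly.monom[OF this(3,2), of c] show ?case by (simp add: add.assoc)
qed (use assms in simp)

lemma trig_poly_scale: "trig_poly K p \<Longrightarrow> trig_poly K (\<lambda>z. d * p z)"
proof (induction rule: trig_poly.induct)
  case (monom p k c)
  from trig_poly.monom[OF this(3,2), of "d * c"] show ?case by (simp add: algebra_simps)
qed (simp add: trig_poly.zero)

lemma trig_poly_const: "0 \<in> K \<Longrightarrow> trig_poly K (\<lambda>z. c)"
  using trig_poly.monom[OF trig_poly.zero, of 0 K c] by simp

text \<open>Sorting the monomials by frequency; with nonnegative and negative frequencies this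
  yields the analytic part of an approximant.\<close>

lemma trig_poly_split:
  assumes "trig_poly (K \<union> L) p"
  shows "\<exists>q r. trig_poly K q \<and> trig_poly L r \<and> p = (\<lambda>z. q z + r z)"
  using assms
proof (induction rule: trig_poly.induct)
  case zero
  then show ?case using trig_poly.zero by fastforce
next
  case (monom p k c)
  then obtain q r where *: "trig_poly K q" "trig_poly L r" "p = (\<lambda>z. q z + r z)" by blast
  from monom(2) show ?case
  proof
    assume "k \<in> K"
    from trig_poly.monom[OF *(1) this, of c] *(2,3) show ?thesis
      by (intro exI[of _ "\<lambda>z. q z + c * z powi k"] exI[of _ r]) (auto simp: algebra_simps)
  next
    assume "k \<in> L"
    from trig_poly.monom[OF *(2) this, of c] *(1,3) show ?thesis
      by (intro exI[of _ q] exI[of _ "\<lambda>z. r z + c * z powi k"]) (auto simp: algebra_simps)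
  qed
qed

text \<open>A real linear form combines Re z and Im z, and on the circle, where the conjugate of z
  is its inverse, both are Laurent polynomials of degree one.\<close>

lemma real_linear_circle:
  assumes "bounded_linear (P :: complex \<Rightarrow> real)"
  obtains u where "\<And>z. cmod z = 1 \<Longrightarrow> of_real (P z) = u * z + cnj u * z powi (-1)"
proof -
  interpret P: bounded_linear P by fact
  have P: "P z = Re z * P 1 + Im z * P \<i>" for z
  proof -
    have "P z = P (Re z *\<^sub>R 1 + Im z *\<^sub>R \<i>)"
      by (rule arg_cong[of _ _ P]) (simp add: complex_eq_iff)
    then show ?thesis by (simp only: P.add P.scaleR) simp
  qed
  have "of_real (P z) = Complex (P 1 / 2) (- (P \<i> / 2)) * z + cnj (Complex (P 1 / 2) (- (P \<i> / 2))) * z powi (-1)"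
    if "cmod z = 1" for z
  proof -
    have "z * cnj z = 1" "z \<noteq> 0"
      using that by (auto simp: complex_norm_square[symmetric])
    then have "z powi (-1) = cnj z"
      by (simp add: power_int_minus field_simps)
    then show ?thesis
      by (simp add: P[of z] complex_eq_iff algebra_simps del: power_int_minus)
  qed
  then show thesis by (rule that)
qed

text \<open>Quantifying over the second factor makes the product case of the induction immediate.\<close>

lemma trig_poly_mult_poly:
  assumes "real_polynomial_function P" "trig_poly UNIV p"
  shows "\<exists>q. trig_poly UNIV q \<and> (\<forall>z\<in>circle. q z = of_real (P z) * p z)"
  using assms
proof (induction arbitrary: p rule: real_polynomial_function.induct)
  case (linear P)
  from linear(1) obtain u where u: "\<And>z. cmod z = 1 \<Longrightarrow> of_real (P z) = u * z + cnj u * z powi (-1)"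
    using real_linear_circle by blast
  from linear(2) show ?case
  proof (induction rule: trig_poly.induct)
    case zero
    then show ?case using trig_poly.zero by fastforce
  next
    case (monom p k c)
    then obtain q where q: "trig_poly UNIV q" "\<forall>z\<in>circle. q z = of_real (P z) * p z" by auto
    define q' where "q' z = (q z + (u * c) * z powi (k + 1)) + (cnj u * c) * z powi (k - 1)" for z
    have "trig_poly UNIV q'"
      unfolding q'_def by (intro trig_poly.monom q) auto
    moreover have "q' z = of_real (P z) * (p z + c * z powi k)" if "cmod z = 1" for z
    proof -
      have "z \<noteq> 0" using that by auto
      then show ?thesis
        using q(2) u[OF that] that
        by (simp add: q'_def power_int_add power_int_diff power_int_minus divide_inverse algebra_simps)
    qed
    ultimately show ?case by auto
  qed
next
  case (const c)
  then show ?case using trig_poly_scale by blast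
next
  case (add f g)
  obtain q r where "trig_poly UNIV q" "\<forall>z\<in>circle. q z = of_real (f z) * p z"
      "trig_poly UNIV r" "\<forall>z\<in>circle. r z = of_real (g z) * p z"
    using add.IH add.prems by blast
  then show ?case
    by (intro exI[of _ "\<lambda>z. q z + r z"]) (auto intro: trig_poly_add simp: algebra_simps)
next
  case (mult f g)
  then obtain r where r: "trig_poly UNIV r" "\<forall>z\<in>circle. r z = of_real (g z) * p z" by blast
  with mult obtain q where "trig_poly UNIV q" "\<forall>z\<in>circle. q z = of_real (f z) * r z" by blast
  with r show ?case by (intro exI[of _ q]) auto
qed

text \<open>Components of pairs in L, inner functions and trigonometric polynomials all lie in this
  class. Unlike L^2 it is closed under products, so integrability never has to be discussed factor
  by factor.\<close>

definition ess_bounded :: "'a measure \<Rightarrow> ('a \<Rightarrow> complex) \<Rightarrow> bool" where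
  "ess_bounded M f \<longleftrightarrow> f \<in> borel_measurable M \<and> (\<exists>C. AE x in M. cmod (f x) \<le> C)"

lemma ess_bounded_measurable [measurable_dest]: "ess_bounded M f \<Longrightarrow> f \<in> borel_measurable M"
  by (simp add: ess_bounded_def)

lemma ess_boundedI: "f \<in> borel_measurable M \<Longrightarrow> (AE x in M. cmod (f x) \<le> C) \<Longrightarrow> ess_bounded M f"
  by (auto simp: ess_bounded_def)

lemma ess_bounded_const: "ess_bounded M (\<lambda>x. c)"
  by (rule ess_boundedI[of _ _ "cmod c"]) auto

lemma ess_bounded_add:
  assumes "ess_bounded M f" "ess_bounded M g"
  shows "ess_bounded M (\<lambda>x. f x + g x)"
proof -
  obtain C D where "AE x in M. cmod (f x) \<le> C" "AE x in M. cmod (g x) \<le> D"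
    using assms by (auto simp: ess_bounded_def)
  then have "AE x in M. cmod (f x + g x) \<le> C + D"
    by eventually_elim (rule norm_triangle_mono)
  with assms show ?thesis by (auto intro!: ess_boundedI dest: ess_bounded_measurable)
qed

lemma ess_bounded_mult:
  assumes "ess_bounded M f" "ess_bounded M g"
  shows "ess_bounded M (\<lambda>x. f x * g x)"
proof -
  obtain C D where "AE x in M. cmod (f x) \<le> C" "AE x in M. cmod (g x) \<le> D"
    using assms by (auto simp: ess_bounded_def)
  then have "AE x in M. cmod (f x * g x) \<le> C * D"
  proof eventually_elim
    case (elim x)
    then have "0 \<le> C" using norm_ge_zero order_trans by blast
    with elim show ?case by (auto simp: norm_mult intro: mult_mono)
  qed
  with assms show ?thesis by (auto intro!: ess_boundedI dest: ess_bounded_measurable)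
qed

lemma borel_measurable_cnj [measurable]:
  "f \<in> borel_measurable M \<Longrightarrow> (\<lambda>x. cnj (f x)) \<in> borel_measurable M"
  by (rule borel_measurable_continuous_on[where f = cnj]) (auto intro: continuous_intros)

lemma ess_bounded_cnj: "ess_bounded M f \<Longrightarrow> ess_bounded M (\<lambda>x. cnj (f x))"
  unfolding ess_bounded_def by (auto simp: borel_measurable_cnj)

lemma ess_bounded_uminus: "ess_bounded M f \<Longrightarrow> ess_bounded M (\<lambda>x. - f x)"
  unfolding ess_bounded_def by auto

lemma ess_bounded_diff: "ess_bounded M f \<Longrightarrow> ess_bounded M g \<Longrightarrow> ess_bounded M (\<lambda>x. f x - g x)"
  using ess_bounded_add[OF _ ess_bounded_uminus] by fastforce

lemmas ess_bounded_intros = ess_bounded_const ess_bounded_add ess_bounded_mult ess_bounded_cnj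
  ess_bounded_uminus ess_bounded_diff

lemma (in finite_measure) ess_bounded_integrable: "ess_bounded M f \<Longrightarrow> integrable M f"
  by (auto simp: ess_bounded_def intro: integrable_const_bound)

lemma (in finite_measure) ess_bounded_integrable2:
  assumes "ess_bounded M f"
  shows "integrable M (\<lambda>x. (cmod (f x))\<^sup>2)"
proof -
  have "integrable M (\<lambda>x. cmod (f x * cnj (f x)))"
    by (intro integrable_norm ess_bounded_integrable ess_bounded_intros assms)
  then show ?thesis by (simp add: norm_mult power2_eq_square)
qed

lemma ess_bounded_powi: "ess_bounded haar (\<lambda>z. z powi k)"
  by (rule ess_boundedI[of _ _ 1]) (auto intro!: AE_I2 simp: norm_powi_circle)

lemma ess_bounded_trig_poly: "trig_poly K p \<Longrightarrow> ess_bounded haar p"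
  using trig_poly_bounded[of K p] trig_poly_measurable[of K p]
  by (fastforce simp: ess_bounded_def intro: AE_I2)

lemma norm_add_sq_le: "(cmod (x + y))\<^sup>2 \<le> 2 * (cmod x)\<^sup>2 + 2 * (cmod y)\<^sup>2"
proof -
  have "(cmod (x + y))\<^sup>2 \<le> (cmod x + cmod y)\<^sup>2"
    by (intro power_mono norm_triangle_ineq) auto
  also have "\<dots> \<le> 2 * (cmod x)\<^sup>2 + 2 * (cmod y)\<^sup>2"
    using sum_squares_bound[of "cmod x" "cmod y"] by (simp add: power2_sum)
  finally show ?thesis .
qed

text \<open>A triangle inequality for squared norms; the constant 2 is the price for avoiding square
  roots and explains the tolerances e / 4 below.\<close>

lemma (in finite_measure) integral_add_sq_le:
  assumes "ess_bounded M f" "ess_bounded M g"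
  shows "(\<integral>x. (cmod (f x + g x))\<^sup>2 \<partial>M) \<le> 2 * (\<integral>x. (cmod (f x))\<^sup>2 \<partial>M) + 2 * (\<integral>x. (cmod (g x))\<^sup>2 \<partial>M)"
proof -
  note [simp] = ess_bounded_integrable2[OF assms(1)] ess_bounded_integrable2[OF assms(2)]
    ess_bounded_integrable2[OF ess_bounded_add[OF assms]]
  have "(\<integral>x. (cmod (f x + g x))\<^sup>2 \<partial>M) \<le> (\<integral>x. 2 * (cmod (f x))\<^sup>2 + 2 * (cmod (g x))\<^sup>2 \<partial>M)"
    by (intro integral_mono norm_add_sq_le) auto
  then show ?thesis by simp
qed

lemma ess_bounded_cis:
  assumes "ess_bounded haar f"
  shows "ess_bounded angle (\<lambda>t. f (cis t))"
proof -
  obtain C where "AE z in haar. cmod (f z) \<le> C" using assms by (auto simp: ess_bounded_def)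
  then have "AE t in angle. cmod (f (cis t)) \<le> C"
    unfolding haar_def by (rule AE_distrD[rotated]) (use cis_measurable in \<open>simp add: haar_def\<close>)
  with assms show ?thesis by (auto intro!: ess_boundedI dest: ess_bounded_measurable)
qed

section \<open>Density of trigonometric polynomials in L^2\<close>

definition trig_approx :: "(real \<Rightarrow> complex) \<Rightarrow> bool" where
  "trig_approx f \<longleftrightarrow> ess_bounded angle f \<and>
     (\<forall>e>0. \<exists>p. trig_poly UNIV p \<and> (\<integral>t. (cmod (f t - p (cis t)))\<^sup>2 \<partial>angle) < e)"

text \<open>Approximability is a closed condition in L^2. It is phrased in the parameter t, so that
  it can later be tested on indicators of Borel sets of the real line.\<close>

lemma trig_approx_closure:
  assumes f: "ess_bounded angle f"
    and approx: "\<And>e. e > 0 \<Longrightarrow> \<exists>g. trig_approx g \<and> (\<integral>t. (cmod (f t - g t))\<^sup>2 \<partial>angle) < e"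
  shows "trig_approx f"
  unfolding trig_approx_def
proof (intro conjI f allI impI)
  fix e :: real assume "e > 0"
  then obtain g where g: "trig_approx g" "(\<integral>t. (cmod (f t - g t))\<^sup>2 \<partial>angle) < e / 4"
    using approx[of "e / 4"] by auto
  with \<open>e > 0\<close> obtain p where p: "trig_poly UNIV p" "(\<integral>t. (cmod (g t - p (cis t)))\<^sup>2 \<partial>angle) < e / 4"
    unfolding trig_approx_def by (meson divide_pos_pos zero_less_numeral)
  have "ess_bounded angle g" using g by (simp add: trig_approx_def)
  with f have "(\<integral>t. (cmod ((f t - g t) + (g t - p (cis t))))\<^sup>2 \<partial>angle) \<le>
      2 * (\<integral>t. (cmod (f t - g t))\<^sup>2 \<partial>angle) + 2 * (\<integral>t. (cmod (g t - p (cis t)))\<^sup>2 \<partial>angle)"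
    by (intro angle.integral_add_sq_le ess_bounded_intros ess_bounded_cis ess_bounded_trig_poly[OF p(1)])
  also have "\<dots> < e" using g p by simp
  finally show "\<exists>p. trig_poly UNIV p \<and> (\<integral>t. (cmod (f t - p (cis t)))\<^sup>2 \<partial>angle) < e"
    using p(1) by auto
qed

lemma trig_approx_trig_poly: "trig_poly UNIV p \<Longrightarrow> trig_approx (\<lambda>t. p (cis t))"
  unfolding trig_approx_def
  by (auto intro!: ess_bounded_cis ess_bounded_trig_poly exI[of _ p])

lemma trig_approx_zero: "trig_approx (\<lambda>t. 0)"
  using trig_approx_trig_poly[OF trig_poly.zero] .

lemma trig_approx_add:
  assumes f: "trig_approx f" and g: "trig_approx g"
  shows "trig_approx (\<lambda>t. f t + g t)"
  unfolding trig_approx_def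
proof (intro conjI allI impI)
  show "ess_bounded angle (\<lambda>t. f t + g t)"
    using f g by (auto simp: trig_approx_def intro: ess_bounded_intros)
  fix e :: real assume "e > 0"
  then have "e / 4 > 0" by simp
  with f g obtain p q where p: "trig_poly UNIV p" "(\<integral>t. (cmod (f t - p (cis t)))\<^sup>2 \<partial>angle) < e / 4"
      and q: "trig_poly UNIV q" "(\<integral>t. (cmod (g t - q (cis t)))\<^sup>2 \<partial>angle) < e / 4"
    unfolding trig_approx_def by meson
  have "(\<integral>t. (cmod ((f t - p (cis t)) + (g t - q (cis t))))\<^sup>2 \<partial>angle) \<le>
      2 * (\<integral>t. (cmod (f t - p (cis t)))\<^sup>2 \<partial>angle) + 2 * (\<integral>t. (cmod (g t - q (cis t)))\<^sup>2 \<partial>angle)"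
    using f g p q unfolding trig_approx_def
    by (intro angle.integral_add_sq_le ess_bounded_intros ess_bounded_cis ess_bounded_trig_poly) auto
  also have "\<dots> < e" using p q by simp
  finally show "\<exists>p. trig_poly UNIV p \<and> (\<integral>t. (cmod (f t + g t - p (cis t)))\<^sup>2 \<partial>angle) < e"
    using trig_poly_add[OF p(1) q(1)] by (intro exI[of _ "\<lambda>z. p z + q z"]) (simp add: algebra_simps)
qed

lemma trig_approx_scale:
  assumes f: "trig_approx f"
  shows "trig_approx (\<lambda>t. c * f t)"
  unfolding trig_approx_def
proof (intro conjI allI impI)
  show "ess_bounded angle (\<lambda>t. c * f t)"
    using f by (auto simp: trig_approx_def intro: ess_bounded_intros)
  fix e :: real assume "e > 0"
  then have "e / ((cmod c)\<^sup>2 + 1) > 0" by (simp add: add_nonneg_pos)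
  with f obtain p where p: "trig_poly UNIV p" "(\<integral>t. (cmod (f t - p (cis t)))\<^sup>2 \<partial>angle) < e / ((cmod c)\<^sup>2 + 1)"
    unfolding trig_approx_def by meson
  have "(\<integral>t. (cmod (c * f t - c * p (cis t)))\<^sup>2 \<partial>angle) = (cmod c)\<^sup>2 * (\<integral>t. (cmod (f t - p (cis t)))\<^sup>2 \<partial>angle)"
    by (simp flip: right_diff_distrib add: norm_mult power_mult_distrib)
  also have "\<dots> \<le> ((cmod c)\<^sup>2 + 1) * (\<integral>t. (cmod (f t - p (cis t)))\<^sup>2 \<partial>angle)"
    by (intro mult_right_mono) auto
  also have "\<dots> < e"
    using p(2) by (simp add: pos_less_divide_eq add_nonneg_pos mult.commute)
  finally show "\<exists>p. trig_poly UNIV p \<and> (\<integral>t. (cmod (c * f t - p (cis t)))\<^sup>2 \<partial>angle) < e"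
    using trig_poly_scale[OF p(1)] by auto
qed

text \<open>Under a common bound, dominated convergence upgrades almost everywhere convergence to
  L^2 convergence, and closedness applies.\<close>

lemma trig_approx_limit:
  assumes g: "\<And>n. trig_approx (g n)" and f[measurable]: "f \<in> borel_measurable angle"
    and C: "\<And>n. AE t in angle. cmod (g n t) \<le> C"
    and lim: "AE t in angle. (\<lambda>n. g n t) \<longlonglongrightarrow> f t"
  shows "trig_approx f"
proof -
  have [measurable]: "g n \<in> borel_measurable angle" for n
    using g by (auto simp: trig_approx_def ess_bounded_def)
  have C': "AE t in angle. \<forall>n. cmod (g n t) \<le> C" using C by (simp add: AE_all_countable)
  have fC: "AE t in angle. cmod (f t) \<le> C"
    using C' lim by eventually_elim (rule LIMSEQ_le_const2[OF tendsto_norm], auto)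
  show ?thesis
  proof (rule trig_approx_closure)
    show "ess_bounded angle f" using fC by (rule ess_boundedI[rotated]) simp
    fix e :: real assume "e > 0"
    have "(\<lambda>n. \<integral>t. (cmod (f t - g n t))\<^sup>2 \<partial>angle) \<longlonglongrightarrow> (\<integral>t. 0 \<partial>angle)"
    proof (rule integral_dominated_convergence[where w = "\<lambda>_. (2 * C)\<^sup>2"])
      show "AE t in angle. (\<lambda>n. (cmod (f t - g n t))\<^sup>2) \<longlonglongrightarrow> 0"
        using lim by eventually_elim (rule tendsto_eq_intros | assumption | simp)+
      show "AE t in angle. norm ((cmod (f t - g n t))\<^sup>2) \<le> (2 * C)\<^sup>2" for n
        using C[of n] fC
      proof eventually_elim
        case (elim t)
        then have "cmod (f t - g n t) \<le> 2 * C" using norm_triangle_ineq4[of "f t" "g n t"] by linarith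
        then have "(cmod (f t - g n t))\<^sup>2 \<le> (2 * C)\<^sup>2" by (rule power_mono) simp
        then show ?case by simp
      qed
    qed simp_all
    then have "eventually (\<lambda>n. (\<integral>t. (cmod (f t - g n t))\<^sup>2 \<partial>angle) < e) sequentially"
      using \<open>e > 0\<close> by (auto dest: order_tendstoD)
    then show "\<exists>h. trig_approx h \<and> (\<integral>t. (cmod (f t - h t))\<^sup>2 \<partial>angle) < e"
      using g by (auto dest!: eventually_happens)
  qed
qed

text \<open>Stone-Weierstrass on the compact circle in the real plane gives a uniformly close real
  polynomial, and on the circle this is a trigonometric polynomial.\<close>

lemma trig_approx_continuous:
  fixes \<phi> :: "complex \<Rightarrow> real"
  assumes cont: "continuous_on UNIV \<phi>"
  shows "trig_approx (\<lambda>t. of_real (\<phi> (cis t)))"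
proof (rule trig_approx_closure)
  have "circle = sphere 0 1" by (auto simp: dist_norm)
  then have compact_circle: "compact circle" by simp
  have [measurable]: "\<phi> \<in> borel_measurable borel" using cont by (rule borel_measurable_continuous_onI)
  have "compact (\<phi> ` circle)"
    using compact_circle by (intro compact_continuous_image continuous_on_subset[OF cont]) auto
  then have "bounded (\<phi> ` circle)" by (rule compact_imp_bounded)
  then obtain C where "\<forall>x\<in>\<phi> ` circle. norm x \<le> C" unfolding bounded_iff by blast
  then have C: "\<bar>\<phi> z\<bar> \<le> C" if "cmod z = 1" for z using that by auto
  have "(\<lambda>z. complex_of_real (\<phi> z)) \<in> borel_measurable haar"
    by (rule measurable_compose[OF measurable_ident_haar]) measurable
  then have "ess_bounded haar (\<lambda>z. complex_of_real (\<phi> z))"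
    by (rule ess_boundedI[of _ _ C]) (use C in \<open>auto intro!: AE_I2\<close>)
  then show "ess_bounded angle (\<lambda>t. of_real (\<phi> (cis t)))"
    by (rule ess_bounded_cis)
  fix e :: real assume e: "e > 0"
  \<comment> \<open>The uniform error enters squared; e / 2 in place of e leaves room for a strict
    inequality after integration.\<close>
  then have "sqrt (e / 2) > 0" by simp
  with compact_circle continuous_on_subset[OF cont subset_UNIV]
  have "\<exists>P. real_polynomial_function P \<and> (\<forall>z\<in>circle. \<bar>\<phi> z - P z\<bar> < sqrt (e / 2))"
    by (rule Stone_Weierstrass_real_polynomial_function) blast
  then obtain P where P: "real_polynomial_function P" "\<And>z. z \<in> circle \<Longrightarrow> \<bar>\<phi> z - P z\<bar> < sqrt (e / 2)"
    by blast
  \<comment> \<open>Multiplying the constant polynomial 1 by P turns P itself into a trigonometric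
    polynomial.\<close>
  obtain q where q: "trig_poly UNIV q" "\<And>z. z \<in> circle \<Longrightarrow> q z = of_real (P z)"
    using trig_poly_mult_poly[OF P(1) trig_poly_const[of UNIV 1]] by auto
  have "(\<integral>t. (cmod (of_real (\<phi> (cis t)) - q (cis t)))\<^sup>2 \<partial>angle) \<le> (\<integral>t. e / 2 \<partial>angle)"
  proof (rule integral_mono')
    fix t
    have "cmod (of_real (\<phi> (cis t)) - q (cis t)) = \<bar>\<phi> (cis t) - P (cis t)\<bar>"
      using q(2)[of "cis t"] by (simp flip: of_real_diff)
    also have "\<dots> \<le> sqrt (e / 2)" using P(2)[of "cis t"] by simp
    finally have "(cmod (of_real (\<phi> (cis t)) - q (cis t)))\<^sup>2 \<le> (sqrt (e / 2))\<^sup>2"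
      by (rule power_mono) simp
    then show "(cmod (of_real (\<phi> (cis t)) - q (cis t)))\<^sup>2 \<le> e / 2" using e by simp
  qed (use e in auto)
  also have "\<dots> = e / 2" using angle.prob_space by simp
  finally show "\<exists>g. trig_approx g \<and> (\<integral>t. (cmod (of_real (\<phi> (cis t)) - g t))\<^sup>2 \<partial>angle) < e"
    using e trig_approx_trig_poly[OF q(1)] by (intro exI[of _ "\<lambda>t. q (cis t)"]) auto
qed

lemma measurable_angle_borel [measurable]: "(\<lambda>t. t) \<in> borel_measurable angle"
  unfolding measurable_angle_iff set_borel_measurable_def by measurable

text \<open>The image S of \<open>K \<inter> circ\<close> under \<open>cis\<close> is compact, and
  continuous bumps shrinking to S converge pointwise to its indicator, which pulls back to that of K
  up to a null set.\<close>

lemma trig_approx_closed: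
  assumes K: "closed K"
  shows "trig_approx (indicator K)"
proof -
  have [measurable]: "K \<in> sets borel" using K by (rule borel_closed)
  define S where "S = cis ` (K \<inter> circ)"
  have "compact (K \<inter> circ)" using K by (simp add: circ_def closed_Int_compact)
  then have "compact S" unfolding S_def by (intro compact_continuous_image continuous_intros)
  then have S: "closed S" by (rule compact_imp_closed)
  \<comment> \<open>Parameters with the same value of \<open>cis\<close> differ by a multiple of 2
    pi. Once t is neither 0 nor 2 pi, it is less than 2 pi away from every other parameter, so
    membership in S decides membership in K.\<close>
  have iff: "AE t in angle. cis t \<in> S \<longleftrightarrow> t \<in> K"
    unfolding AE_angle_iff using AE_lborel_singleton[of 0] AE_lborel_singleton[of "2 * pi"]
  proof eventually_elim
    case (elim t)
    show ?case
    proof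
      assume t: "t \<in> circ"
      have "t = s" if "s \<in> circ" "cis t = cis s" for s
      proof -
        have "cos t = cos s" "sin t = sin s"
          using that(2) by (simp_all add: complex_eq_iff)
        then have "cos (t - s) = 1" by (simp add: cos_diff)
        then obtain n :: int where n: "t - s = of_int n * 2 * pi" by (auto simp: cos_one_2pi_int)
        have "\<bar>t - s\<bar> < 2 * pi"
          using t elim that(1) by (auto simp: circ_def)
        then have "\<bar>of_int n\<bar> < (1::real)" unfolding n by (simp add: abs_mult)
        then have "n = 0" by linarith
        then show ?thesis using n by simp
      qed
      then show "cis t \<in> S \<longleftrightarrow> t \<in> K"
        using t by (auto simp: S_def)
    qed
  qed
  show ?thesis
  \<comment> \<open>By convention \<open>infdist\<close> to the empty set is 0, so the bumps used
    below would be constantly 1 there; the empty set is treated apart.\<close>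
  proof (cases "S = {}")
    case True
    show ?thesis
    proof (rule trig_approx_limit[of "\<lambda>_ _. 0"])
      show "trig_approx (\<lambda>t. 0)" by (rule trig_approx_zero)
      show "AE t in angle. (\<lambda>n. 0) \<longlonglongrightarrow> (indicator K t :: complex)"
        using iff by eventually_elim (simp add: True)
    qed (use K in auto)
  next
    case False
    \<comment> \<open>A continuous bump equal to 1 on S that vanishes as soon as n times the
      distance to S reaches 1.\<close>
    define \<phi> where "\<phi> n z = max 0 (1 - real n * infdist z S)" for n z
    show ?thesis
    proof (rule trig_approx_limit[of "\<lambda>n t. of_real (\<phi> n (cis t))"])
      show "trig_approx (\<lambda>t. of_real (\<phi> n (cis t)))" for n
        unfolding \<phi>_def by (rule trig_approx_continuous) (intro continuous_intros)
      show "AE t in angle. cmod (of_real (\<phi> n (cis t))) \<le> 1" for n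
        by (auto simp: \<phi>_def infdist_nonneg)
      show "AE t in angle. (\<lambda>n. of_real (\<phi> n (cis t))) \<longlonglongrightarrow> (indicator K t :: complex)"
        using iff
      proof eventually_elim
        case (elim t)
        show ?case
        proof (cases "t \<in> K")
          case True
          then show ?thesis using elim by (simp add: \<phi>_def)
        next
          case out: False
          then have pos: "infdist (cis t) S > 0"
            using elim infdist_pos_not_in_closed[OF S False] by simp
          obtain N where N: "1 / infdist (cis t) S < real N" using reals_Archimedean2 by blast
          have "eventually (\<lambda>n. \<phi> n (cis t) = 0) sequentially"
            using eventually_ge_at_top[of N]
          proof eventually_elim
            case (elim n)
            then have "1 / infdist (cis t) S < real n" using N by linarith
            then show ?case using pos by (simp add: \<phi>_def field_simps max_def)
          qed
          then have "eventually (\<lambda>n. complex_of_real (\<phi> n (cis t)) = 0) sequentially"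
            by eventually_elim simp
          then show ?thesis using out by (simp add: tendsto_eventually)
        qed
      qed
    qed (use K in auto)
  qed
qed

text \<open>A Dynkin argument: closed sets are stable under intersection and generate the Borel
  sets, complements follow by linearity, and countable disjoint unions by bounded limits.\<close>

lemma trig_approx_indicator:
  assumes "A \<in> sets borel"
  shows "trig_approx (indicator A)"
proof -
  have one: "trig_approx (\<lambda>t. 1)"
    using trig_approx_trig_poly[OF trig_poly_const[of UNIV 1]] by simp
  have "Int_stable (Collect (closed :: real set \<Rightarrow> bool))" by (auto simp: Int_stable_def)
  moreover have "Collect (closed :: real set \<Rightarrow> bool) \<subseteq> Pow UNIV" by simp
  moreover have "A \<in> sigma_sets UNIV (Collect closed)"
    using assms by (simp add: borel_eq_closed)
  ultimately show ?thesis
  proof (induction rule: sigma_sets_induct_disjoint)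
    case (basic A)
    then show ?case by (auto intro: trig_approx_closed)
  next
    case empty
    then show ?case using trig_approx_zero by simp
  next
    case (compl A)
    have "trig_approx (\<lambda>t. 1 + (-1) * indicator A t)"
      by (intro trig_approx_add one trig_approx_scale compl)
    also have "(\<lambda>t. 1 + (-1) * indicator A t :: complex) = indicator (UNIV - A)"
      by (rule ext) (auto simp: indicator_def)
    finally show ?case .
  next
    case (union A)
    have [measurable]: "A i \<in> sets borel" for i
    proof -
      have "A i \<in> sigma_sets UNIV (Collect closed)" using union(2) by auto
      then show ?thesis by (simp add: borel_eq_closed)
    qed
    show ?case
    proof (rule trig_approx_limit[of "\<lambda>n t. \<Sum>i<n. indicator (A i) t"])
      show "trig_approx (\<lambda>t. \<Sum>i<n. indicator (A i) t)" for n
      proof (induction n)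
        case 0
        then show ?case using trig_approx_zero by simp
      next
        case (Suc n)
        then show ?case using union(3) by (simp add: trig_approx_add)
      qed
      have sums: "(\<lambda>n. \<Sum>i<n. indicator (A i) t) \<longlonglongrightarrow> (indicator (\<Union>i. A i) t :: real)" for t
        using indicator_sums[of A t] union(1) unfolding sums_def disjoint_family_on_def by auto
      have of_real: "(\<Sum>i<n. indicator (A i) t) = complex_of_real (\<Sum>i<n. indicator (A i) t)" for n t
        by (simp only: of_real_sum of_real_indicator)
      show "AE t in angle. (\<lambda>n. \<Sum>i<n. indicator (A i) t) \<longlonglongrightarrow> (indicator (\<Union>i. A i) t :: complex)"
      proof (rule AE_I2)
        fix t
        have "(\<lambda>n. complex_of_real (\<Sum>i<n. indicator (A i) t)) \<longlonglongrightarrow> complex_of_real (indicator (\<Union>i. A i) t)"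
          by (intro tendsto_of_real sums)
        then show "(\<lambda>n. \<Sum>i<n. indicator (A i) t) \<longlonglongrightarrow> (indicator (\<Union>i. A i) t :: complex)"
          unfolding of_real of_real_indicator .
      qed
      show "AE t in angle. cmod (\<Sum>i<n. indicator (A i) t) \<le> 1" for n
      proof (rule AE_I2)
        fix t
        have "(\<Sum>i<n. indicator (A i) t) \<le> (indicator (\<Union>i. A i) t :: real)"
          using sums[of t] by (rule incseq_le[rotated]) (auto intro!: incseq_SucI)
        also have "\<dots> \<le> 1" by (simp add: indicator_def)
        finally show "cmod (\<Sum>i<n. indicator (A i) t) \<le> 1"
          unfolding of_real norm_of_real by (subst abs_of_nonneg) (auto intro: sum_nonneg)
      qed
    qed simp
  qed
qed

text \<open>A measurable f is a pointwise limit of simple functions of modulus at most 2 |f|. Each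
  of them is a finite combination of indicators, and the bound makes the limit lemma
  applicable.\<close>

lemma trig_approx_ess_bounded:
  assumes f: "ess_bounded angle f"
  shows "trig_approx f"
proof -
  have [measurable]: "f \<in> borel_measurable angle" using f by (rule ess_bounded_measurable)
  obtain C where C: "AE t in angle. cmod (f t) \<le> C" using f by (auto simp: ess_bounded_def)
  have "\<exists>s. (\<forall>i. simple_function angle (s i)) \<and> (\<forall>t\<in>circ. (\<lambda>i. s i t) \<longlonglongrightarrow> f t) \<and>
      (\<forall>i. \<forall>t\<in>circ. cmod (s i t) \<le> 2 * cmod (f t))"
    using borel_measurable_implies_sequence_metric[of f angle 0] by simp
  then obtain s where s: "\<And>i. simple_function angle (s i)" "\<And>t. t \<in> circ \<Longrightarrow> (\<lambda>i. s i t) \<longlonglongrightarrow> f t"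
      "\<And>i t. t \<in> circ \<Longrightarrow> cmod (s i t) \<le> 2 * cmod (f t)"
    by blast
  show ?thesis
  proof (rule trig_approx_limit[of s])
    show "trig_approx (s i)" for i
    proof -
      define F where "F y = s i -` {y} \<inter> circ" for y
      have F: "F y \<in> sets borel" for y
      proof -
        have "F y \<in> sets angle" using simple_functionD(2)[OF s(1), of i "{y}"] by (simp add: F_def)
        then show ?thesis unfolding sets_angle by (subst (asm) sets_restrict_space_iff) auto
      qed
      have "finite (s i ` circ)" using simple_functionD(1)[OF s(1), of i] by simp
      then have sum: "trig_approx (\<lambda>t. \<Sum>y\<in>s i ` circ. y * indicator (F y) t)"
      proof (induction rule: finite_induct)
        case empty
        then show ?case using trig_approx_zero by simp
      next
        case (insert y Y)
        then have "trig_approx (\<lambda>t. y * indicator (F y) t + (\<Sum>y\<in>Y. y * indicator (F y) t))"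
          by (intro trig_approx_add trig_approx_scale trig_approx_indicator F)
        then show ?case by (subst sum.insert[OF insert(1,2)])
      qed
      show ?thesis
      \<comment> \<open>The sequence is constant. The limit lemma serves to pass from the sum to
        \<open>s i\<close>, which are known to agree only on \<open>circ\<close>.\<close>
      proof (rule trig_approx_limit[of "\<lambda>_. \<lambda>t. \<Sum>y\<in>s i ` circ. y * indicator (F y) t"])
        show "s i \<in> borel_measurable angle" using s(1) by (rule borel_measurable_simple_function)
        have eq: "s i t = (\<Sum>y\<in>s i ` circ. y * indicator (F y) t)" if "t \<in> circ" for t
        proof -
          have "s i t = (\<Sum>y\<in>s i ` circ. indicator (F y) t *\<^sub>R y)"
            using simple_function_indicator_representation_banach[OF s(1), of t i] that
            by (simp only: space_angle F_def)
          also have "\<dots> = (\<Sum>y\<in>s i ` circ. y * indicator (F y) t)"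
            by (rule sum.cong) (simp_all add: indicator_def)
          finally show ?thesis .
        qed
        show "AE t in angle. (\<lambda>n. \<Sum>y\<in>s i ` circ. y * indicator (F y) t) \<longlonglongrightarrow> s i t"
          by (rule AE_I2) (simp only: eq[symmetric] space_angle tendsto_const)
        show "AE t in angle. cmod (\<Sum>y\<in>s i ` circ. y * indicator (F y) t) \<le> 2 * C"
          using C AE_space
        proof eventually_elim
          case (elim t)
          then have "cmod (s i t) \<le> 2 * C" using s(3)[of t i] by simp
          then show ?case using elim by (simp only: eq[symmetric] space_angle)
        qed
      qed (use sum in auto)
    qed
    show "AE t in angle. (\<lambda>n. s n t) \<longlonglongrightarrow> f t" using s(2) by (auto intro!: AE_I2)
    show "AE t in angle. cmod (s n t) \<le> 2 * C" for n
      using C AE_space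
    proof eventually_elim
      case (elim t)
      then show ?case using s(3)[of t n] by simp
    qed
  qed simp
qed

lemma trig_poly_dense:
  assumes f: "ess_bounded haar f" and "e > 0"
  obtains p where "trig_poly UNIV p" "(\<integral>z. (cmod (f z - p z))\<^sup>2 \<partial>haar) < e"
proof -
  obtain p where p: "trig_poly UNIV p" "(\<integral>t. (cmod (f (cis t) - p (cis t)))\<^sup>2 \<partial>angle) < e"
    using trig_approx_ess_bounded[OF ess_bounded_cis[OF f]] \<open>e > 0\<close> unfolding trig_approx_def by meson
  moreover have "(\<integral>z. (cmod (f z - p z))\<^sup>2 \<partial>haar) = (\<integral>t. (cmod (f (cis t) - p (cis t)))\<^sup>2 \<partial>angle)"
    using ess_bounded_measurable[OF f] trig_poly_measurable[OF p(1)] by (subst integral_haar_angle) auto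
  ultimately show thesis using that by simp
qed

section \<open>Fourier coefficients of bounded functions\<close>

text \<open>This is nonnegativity of the variance of |f|.\<close>

lemma (in prob_space) integral_norm_le_L2:
  assumes f: "ess_bounded M f"
  shows "(\<integral>x. cmod (f x) \<partial>M) \<le> sqrt (\<integral>x. (cmod (f x))\<^sup>2 \<partial>M)"
proof (rule real_le_rsqrt)
  have "variance (\<lambda>x. cmod (f x)) = (\<integral>x. (cmod (f x))\<^sup>2 \<partial>M) - (\<integral>x. cmod (f x) \<partial>M)\<^sup>2"
    using ess_bounded_integrable[OF f] ess_bounded_integrable2[OF f] by (intro variance_eq) auto
  then show "(\<integral>x. cmod (f x) \<partial>M)\<^sup>2 \<le> (\<integral>x. (cmod (f x))\<^sup>2 \<partial>M)"
    using variance_positive[of "\<lambda>x. cmod (f x)"] by simp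
qed

lemma fourier_cong:
  assumes "\<And>z. cmod z = 1 \<Longrightarrow> f z = g z"
  shows "fourier f k = fourier g k"
  using assms by (simp add: fourier_def)

lemma fourier_cong_AE:
  assumes "f \<in> borel_measurable haar" "g \<in> borel_measurable haar" "AE z in haar. f z = g z"
  shows "fourier f k = fourier g k"
  using assms by (auto simp: fourier_haar intro!: integral_cong_AE)

lemma ess_bounded_times_powi: "ess_bounded haar f \<Longrightarrow> ess_bounded haar (\<lambda>z. f z * z powi k)"
  by (intro ess_bounded_intros ess_bounded_powi)

lemma fourier_add:
  assumes "ess_bounded haar f" "ess_bounded haar g"
  shows "fourier (\<lambda>z. f z + g z) k = fourier f k + fourier g k"
  using assms haar.ess_bounded_integrable[OF ess_bounded_times_powi]
  by (simp add: fourier_haar ess_bounded_measurable ring_distribs)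

lemma fourier_diff:
  assumes "ess_bounded haar f" "ess_bounded haar g"
  shows "fourier (\<lambda>z. f z - g z) k = fourier f k - fourier g k"
  using assms haar.ess_bounded_integrable[OF ess_bounded_times_powi]
  by (simp add: fourier_haar ess_bounded_measurable ring_distribs)

lemma fourier_scale:
  assumes "f \<in> borel_measurable haar"
  shows "fourier (\<lambda>z. c * f z) k = c * fourier f k"
  using assms by (simp add: fourier_haar mult.assoc)

lemma cnj_powi_circle: "cmod z = 1 \<Longrightarrow> cnj (z powi k) = z powi (- k)"
proof -
  assume "cmod z = 1"
  then have "z * cnj z = 1" "z \<noteq> 0" by (auto simp: complex_norm_square[symmetric])
  then have "cnj z = inverse z" by (simp add: field_simps)
  then show ?thesis by (simp add: power_int_minus power_int_inverse)
qed

lemma fourier_cnj: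
  assumes [measurable]: "f \<in> borel_measurable haar"
  shows "fourier (\<lambda>z. cnj (f z)) k = cnj (fourier f (- k))"
proof -
  have "fourier (\<lambda>z. cnj (f z)) k = (\<integral>z. cnj (f z * z powi k) \<partial>haar)"
    unfolding fourier_haar[OF borel_measurable_cnj[OF assms]]
    by (rule Bochner_Integration.integral_cong) (simp_all only: complex_cnj_mult cnj_powi_circle space_haar mem_Collect_eq)
  also have "\<dots> = cnj (\<integral>z. f z * z powi k \<partial>haar)" by (simp del: complex_cnj_mult)
  finally show ?thesis by (simp add: fourier_haar)
qed

lemma fourier_shift:
  assumes [measurable]: "f \<in> borel_measurable haar"
  shows "fourier (\<lambda>z. z powi j * f z) k = fourier f (k - j)"
proof -
  have "z powi j * f z * z powi - k = f z * z powi - (k - j)" if "cmod z = 1" for z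
  proof -
    have "z \<noteq> 0" using that by auto
    then have "z powi j * z powi - k = z powi - (k - j)"
      using power_int_add[of z j "- k"] by simp
    then show ?thesis by (simp add: mult_ac)
  qed
  then have "(\<integral>z. z powi j * f z * z powi - k \<partial>haar) = (\<integral>z. f z * z powi - (k - j) \<partial>haar)"
    by (intro Bochner_Integration.integral_cong) auto
  then show ?thesis by (simp add: fourier_haar)
qed

lemma fourier_const: "fourier (\<lambda>z. c) k = (if k = 0 then c else 0)"
  by (simp add: fourier_haar integral_powi)

lemma fourier_powi: "fourier (\<lambda>z. z powi j) k = (if k = j then 1 else 0)"
  using fourier_shift[of "\<lambda>_. 1" j k] by (simp add: fourier_const)

lemma norm_fourier_le:
  assumes "ess_bounded haar f"
  shows "cmod (fourier f k) \<le> (\<integral>z. cmod (f z) \<partial>haar)"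
proof -
  have "cmod (fourier f k) \<le> (\<integral>z. cmod (f z * z powi - k) \<partial>haar)"
    using assms by (auto simp: fourier_haar ess_bounded_measurable)
  also have "\<dots> = (\<integral>z. cmod (f z) \<partial>haar)"
    by (intro Bochner_Integration.integral_cong) (simp_all add: norm_mult norm_powi_circle)
  finally show ?thesis .
qed

lemma norm_fourier_le_L2:
  assumes "ess_bounded haar f"
  shows "cmod (fourier f k) \<le> sqrt (\<integral>z. (cmod (f z))\<^sup>2 \<partial>haar)"
  using norm_fourier_le[OF assms] haar.integral_norm_le_L2[OF assms] by (rule order_trans)

text \<open>Dominated convergence, with the constant C as integrable majorant on a probability
  space.\<close>

lemma fourier_limit:
  assumes [measurable]: "\<And>n. g n \<in> borel_measurable haar" "f \<in> borel_measurable haar"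
    and C: "\<And>n. AE z in haar. cmod (g n z) \<le> C"
    and lim: "AE z in haar. (\<lambda>n. g n z) \<longlonglongrightarrow> f z"
  shows "(\<lambda>n. fourier (g n) k) \<longlonglongrightarrow> fourier f k"
proof -
  have "(\<lambda>n. \<integral>z. g n z * z powi - k \<partial>haar) \<longlonglongrightarrow> (\<integral>z. f z * z powi - k \<partial>haar)"
  proof (rule integral_dominated_convergence[where w = "\<lambda>_. C"])
    show "AE z in haar. (\<lambda>n. g n z * z powi - k) \<longlonglongrightarrow> f z * z powi - k"
      using lim by eventually_elim (intro tendsto_intros)
    show "AE z in haar. norm (g n z * z powi - k) \<le> C" for n
      using C[of n] AE_space by eventually_elim (simp add: norm_mult norm_powi_circle)
  qed simp_all
  then show ?thesis by (simp add: fourier_haar)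
qed

lemma integral_trig_poly_orthogonal:
  assumes "trig_poly K p" and f: "ess_bounded haar f" and "\<And>k. k \<in> K \<Longrightarrow> fourier f k = 0"
  shows "(\<integral>z. f z * cnj (p z) \<partial>haar) = 0"
  using assms(1)
proof (induction rule: trig_poly.induct)
  case (monom p k c)
  note [measurable] = ess_bounded_measurable[OF f]
  have "(\<integral>z. f z * cnj (p z + c * z powi k) \<partial>haar) = (\<integral>z. f z * cnj (p z) + cnj c * (f z * z powi - k) \<partial>haar)"
    by (intro Bochner_Integration.integral_cong)
       (simp_all only: complex_cnj_add complex_cnj_mult cnj_powi_circle space_haar mem_Collect_eq ring_distribs mult_ac)
  also have "\<dots> = (\<integral>z. f z * cnj (p z) \<partial>haar) + cnj c * (\<integral>z. f z * z powi - k \<partial>haar)"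
    by (subst Bochner_Integration.integral_add)
       (auto intro!: haar.ess_bounded_integrable ess_bounded_intros f ess_bounded_trig_poly[OF monom(1)] ess_bounded_powi)
  also have "\<dots> = 0" using monom assms(3)[OF monom(2)] by (simp add: fourier_haar)
  finally show ?case .
qed simp

lemma cmod_diff_sq: "(cmod (x - y))\<^sup>2 = (cmod x)\<^sup>2 + (cmod y)\<^sup>2 - 2 * Re (x * cnj y)"
  unfolding cmod_power2 by (simp add: power2_eq_square algebra_simps)

text \<open>Here f is orthogonal to p, so the right-hand side exceeds the left by the squared norm
  of p. Hence subtracting forbidden frequencies never brings f closer to 0.\<close>

lemma pythagoras_trig_poly:
  assumes p: "trig_poly K p" and f: "ess_bounded haar f" and "\<And>k. k \<in> K \<Longrightarrow> fourier f k = 0"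
  shows "(\<integral>z. (cmod (f z))\<^sup>2 \<partial>haar) \<le> (\<integral>z. (cmod (f z - p z))\<^sup>2 \<partial>haar)"
proof -
  note p' = ess_bounded_trig_poly[OF p]
  have "(\<integral>z. (cmod (f z - p z))\<^sup>2 \<partial>haar) =
      (\<integral>z. (cmod (f z))\<^sup>2 + (cmod (p z))\<^sup>2 - 2 * Re (f z * cnj (p z)) \<partial>haar)"
    by (simp only: cmod_diff_sq)
  also have "\<dots> = (\<integral>z. (cmod (f z))\<^sup>2 \<partial>haar) + (\<integral>z. (cmod (p z))\<^sup>2 \<partial>haar) - 2 * Re (\<integral>z. f z * cnj (p z) \<partial>haar)"
  proof -
    have int: "integrable haar (\<lambda>z. f z * cnj (p z))"
      by (intro haar.ess_bounded_integrable ess_bounded_intros f p')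
    have "(\<integral>z. 2 * Re (f z * cnj (p z)) \<partial>haar) = 2 * Re (\<integral>z. f z * cnj (p z) \<partial>haar)"
      by (simp only: integral_mult_right_zero integral_Re[OF int])
    moreover have "integrable haar (\<lambda>z. 2 * Re (f z * cnj (p z)))"
      by (intro integrable_mult_right integrable_Re int)
    ultimately show ?thesis
      using haar.ess_bounded_integrable2[OF f] haar.ess_bounded_integrable2[OF p']
      by (simp only: Bochner_Integration.integral_diff Bochner_Integration.integral_add Bochner_Integration.integrable_add)
  qed
  finally show ?thesis
    using integral_trig_poly_orthogonal[OF assms] by (simp add: integral_nonneg_AE)
qed

text \<open>Such an f is orthogonal to every trigonometric polynomial, so its norm is at most its
  distance to any of them, and this distance can be made arbitrarily small.\<close>

lemma fourier_eq_0_imp_AE_eq_0: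
  assumes f: "ess_bounded haar f" and "\<And>k. fourier f k = 0"
  shows "AE z in haar. f z = 0"
proof -
  have "(\<integral>z. (cmod (f z))\<^sup>2 \<partial>haar) \<le> e" if e: "e > 0" for e
  proof -
    obtain p where p: "trig_poly UNIV p" "(\<integral>z. (cmod (f z - p z))\<^sup>2 \<partial>haar) < e"
      by (rule trig_poly_dense[OF f e])
    have "(\<integral>z. (cmod (f z))\<^sup>2 \<partial>haar) \<le> (\<integral>z. (cmod (f z - p z))\<^sup>2 \<partial>haar)"
      by (rule pythagoras_trig_poly[OF p(1) f assms(2)])
    with p(2) show ?thesis by linarith
  qed
  then have "(\<integral>z. (cmod (f z))\<^sup>2 \<partial>haar) \<le> 0"
    by (rule field_le_epsilon) simp
  then have "(\<integral>z. (cmod (f z))\<^sup>2 \<partial>haar) = 0"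
    by (intro antisym integral_nonneg_AE) auto
  then show ?thesis
    using haar.ess_bounded_integrable2[OF f] by (subst (asm) integral_nonneg_eq_0_iff_AE) auto
qed

section \<open>Boundary values of bounded analytic functions, that is H^infinity of the disc\<close>

definition bounded_hardy :: "cfun \<Rightarrow> bool" where
  "bounded_hardy f \<longleftrightarrow> ess_bounded haar f \<and> (\<forall>k<0. fourier f k = 0)"

text \<open>Split an approximant into its analytic part q and its antianalytic part r. Since
  \<open>f - q\<close> has no negative frequencies, it is orthogonal to r, and dropping r only
  improves the approximation.\<close>

lemma bounded_hardy_analytic_dense:
  assumes f: "bounded_hardy f" and "e > 0"
  obtains q where "trig_poly {0..} q" "(\<integral>z. cmod (f z - q z) \<partial>haar) < e"
proof -
  have f': "ess_bounded haar f" "\<And>k. k < 0 \<Longrightarrow> fourier f k = 0" using f by (auto simp: bounded_hardy_def)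
  obtain p where p: "trig_poly UNIV p" "(\<integral>z. (cmod (f z - p z))\<^sup>2 \<partial>haar) < e\<^sup>2"
    by (rule trig_poly_dense[OF f'(1) zero_less_power[OF \<open>e > 0\<close>]])
  have "({0..} \<union> {..<0}) = (UNIV :: int set)" by auto
  then obtain q r where qr: "trig_poly {0..} q" "trig_poly {..<0} r" "p = (\<lambda>z. q z + r z)"
    using trig_poly_split[of "{0..}" "{..<0}" p] p(1) by auto
  note q' = ess_bounded_trig_poly[OF qr(1)]
  have "fourier q k = 0" if "k < 0" for k
    using qr(1)
  proof (induction rule: trig_poly.induct)
    case (monom p j c)
    then show ?case using that
      by (simp add: fourier_add ess_bounded_trig_poly ess_bounded_intros ess_bounded_powi fourier_scale fourier_powi)
  qed (simp add: fourier_const)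
  then have "(\<integral>z. (cmod (f z - q z))\<^sup>2 \<partial>haar) \<le> (\<integral>z. (cmod (f z - q z - r z))\<^sup>2 \<partial>haar)"
    using f' q' by (intro pythagoras_trig_poly[OF qr(2)]) (auto intro: ess_bounded_intros simp: fourier_diff)
  also have "\<dots> < e\<^sup>2" using p(2) by (simp add: qr(3) algebra_simps)
  finally have "sqrt (\<integral>z. (cmod (f z - q z))\<^sup>2 \<partial>haar) < sqrt (e\<^sup>2)" by (rule real_sqrt_less_mono)
  then have "(\<integral>z. cmod (f z - q z) \<partial>haar) < e"
    using haar.integral_norm_le_L2[OF ess_bounded_diff[OF f'(1) q']] \<open>e > 0\<close> by simp
  with qr(1) show thesis by (rule that)
qed

text \<open>A monomial of degree j > 0 contributes the coefficient of h at \<open>k - j < 0\<close>,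
  which is zero; only the constant term of q survives.\<close>

lemma fourier_trig_poly_mult:
  assumes "trig_poly {0..} q" and h: "bounded_hardy h" and k: "k \<le> 0"
  shows "fourier (\<lambda>z. q z * h z) k = fourier q 0 * fourier h k"
  using assms(1)
proof (induction rule: trig_poly.induct)
  case zero
  then show ?case by (simp add: fourier_const)
next
  case (monom q j c)
  have h': "ess_bounded haar h" "\<And>k. k < 0 \<Longrightarrow> fourier h k = 0" using h by (auto simp: bounded_hardy_def)
  note [measurable] = ess_bounded_measurable[OF h'(1)]
  have "fourier (\<lambda>z. (q z + c * z powi j) * h z) k = fourier (\<lambda>z. q z * h z + c * (z powi j * h z)) k"
    by (simp add: algebra_simps)
  also have "\<dots> = fourier (\<lambda>z. q z * h z) k + c * fourier h (k - j)"
    using h'(1) by (simp add: fourier_add ess_bounded_trig_poly[OF monom(1)] ess_bounded_intros ess_bounded_powi fourier_scale fourier_shift)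
  also have "c * fourier h (k - j) = (if j = 0 then c else 0) * fourier h k"
    using h'(2)[of "k - j"] k monom(2) by auto
  also have "fourier (\<lambda>z. q z * h z) k + (if j = 0 then c else 0) * fourier h k = fourier (\<lambda>z. q z + c * z powi j) 0 * fourier h k"
    by (simp add: monom(3) fourier_add ess_bounded_trig_poly[OF monom(1)] ess_bounded_intros ess_bounded_powi fourier_scale fourier_powi ring_distribs)
  finally show ?case .
qed

text \<open>For k = 0 this is multiplicativity of evaluation at the origin, and for k < 0 it says
  that products stay in H^infinity. Both sides are continuous in f for the L^1 norm because h is
  bounded, so analytic polynomials suffice.\<close>

lemma fourier_bounded_hardy_mult:
  assumes f: "bounded_hardy f" and h: "bounded_hardy h" and k: "k \<le> 0"
  shows "fourier (\<lambda>z. f z * h z) k = fourier f 0 * fourier h k"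
proof -
  have f': "ess_bounded haar f" and h': "ess_bounded haar h" using f h by (auto simp: bounded_hardy_def)
  note [measurable] = ess_bounded_measurable[OF f'] ess_bounded_measurable[OF h']
  obtain C where C: "AE z in haar. cmod (h z) \<le> C" using h' by (auto simp: ess_bounded_def)
  \<comment> \<open>Collects the constants of both error terms; the modulus is taken because the
    sign of C is not known, and the summand 1 makes D positive.\<close>
  define D where "D = \<bar>C\<bar> + cmod (fourier h k) + 1"
  have "D > 0" using norm_ge_zero[of "fourier h k"] abs_ge_zero[of C] unfolding D_def by linarith
  have "cmod (fourier (\<lambda>z. f z * h z) k - fourier f 0 * fourier h k) \<le> e" if "e > 0" for e
  proof -
    obtain q where q: "trig_poly {0..} q" "(\<integral>z. cmod (f z - q z) \<partial>haar) < e / D"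
      by (rule bounded_hardy_analytic_dense[OF f divide_pos_pos[OF \<open>e > 0\<close> \<open>D > 0\<close>]])
    note q' = ess_bounded_trig_poly[OF q(1)]
    note fq = ess_bounded_diff[OF f' q']
    have "fourier (\<lambda>z. f z * h z) k - fourier f 0 * fourier h k =
        fourier (\<lambda>z. (f z - q z) * h z) k - fourier (\<lambda>z. f z - q z) 0 * fourier h k"
      using f' h' q' fourier_trig_poly_mult[OF q(1) h k]
      by (simp only: left_diff_distrib fourier_diff ess_bounded_mult) simp
    also have "cmod \<dots> \<le> cmod (fourier (\<lambda>z. (f z - q z) * h z) k) + cmod (fourier (\<lambda>z. f z - q z) 0) * cmod (fourier h k)"
      unfolding norm_mult[symmetric] by (rule norm_triangle_ineq4)
    also have "\<dots> \<le> (\<integral>z. cmod ((f z - q z) * h z) \<partial>haar) + (\<integral>z. cmod (f z - q z) \<partial>haar) * cmod (fourier h k)"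
      by (intro add_mono mult_right_mono norm_fourier_le fq ess_bounded_mult[OF fq h']) auto
    also have "(\<integral>z. cmod ((f z - q z) * h z) \<partial>haar) \<le> (\<integral>z. cmod (f z - q z) * \<bar>C\<bar> \<partial>haar)"
    proof (rule integral_mono_AE)
      show "AE z in haar. cmod ((f z - q z) * h z) \<le> cmod (f z - q z) * \<bar>C\<bar>"
        using C by eventually_elim (auto simp: norm_mult intro!: mult_left_mono)
    qed (intro integrable_norm integrable_mult_left haar.ess_bounded_integrable fq ess_bounded_mult[OF fq h'])+
    also have "\<dots> + (\<integral>z. cmod (f z - q z) \<partial>haar) * cmod (fourier h k) \<le> (\<integral>z. cmod (f z - q z) \<partial>haar) * D"
      by (simp add: D_def algebra_simps)
    also have "\<dots> \<le> e / D * D" using q(2) \<open>D > 0\<close> by (intro mult_right_mono) auto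
    finally show ?thesis using \<open>D > 0\<close> by simp
  qed
  then have "cmod (fourier (\<lambda>z. f z * h z) k - fourier f 0 * fourier h k) \<le> 0"
    by (rule field_le_epsilon) simp
  then show ?thesis by simp
qed

lemma H2D_ess_bounded: "ess_bounded haar f \<Longrightarrow> H2D f \<longleftrightarrow> bounded_hardy f"
  using haar.ess_bounded_integrable2[of f]
  by (auto simp: H2D_def bounded_hardy_def L2T_haar dest: ess_bounded_measurable)

section \<open>Layers\<close>

lemma measurable_haar_cong:
  "(\<And>z. cmod z = 1 \<Longrightarrow> f z = g z) \<Longrightarrow> f \<in> borel_measurable haar \<longleftrightarrow> g \<in> borel_measurable haar"
  by (rule measurable_cong) simp

lemma star_measurable_iff: "star f \<in> borel_measurable haar \<longleftrightarrow> f \<in> borel_measurable haar"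
proof -
  have "star f \<in> borel_measurable haar \<longleftrightarrow> (\<lambda>z. cnj (f z)) \<in> borel_measurable haar"
    by (rule measurable_haar_cong) (rule star_circle)
  also have "\<dots> \<longleftrightarrow> f \<in> borel_measurable haar"
  proof
    assume "(\<lambda>z. cnj (f z)) \<in> borel_measurable haar"
    from borel_measurable_cnj[OF this] show "f \<in> borel_measurable haar" by simp
  qed (rule borel_measurable_cnj)
  finally show ?thesis .
qed

lemma fourier_star:
  assumes "f \<in> borel_measurable haar"
  shows "fourier (star f) k = cnj (fourier f (- k))"
  using fourier_cong[of "star f" "\<lambda>z. cnj (f z)" k] assms by (simp add: star_circle fourier_cnj)

lemma norm_sq_sum_eq_1_iff: "x * cnj x + y * cnj y = 1 \<longleftrightarrow> (cmod x)\<^sup>2 + (cmod y)\<^sup>2 = 1"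
proof -
  have "x * cnj x + y * cnj y = complex_of_real ((cmod x)\<^sup>2 + (cmod y)\<^sup>2)"
    by (simp only: of_real_add complex_norm_square)
  then show ?thesis by (simp only: of_real_eq_1_iff)
qed

section \<open>Membership in L and its closed subspaces through Fourier coefficients\<close>

lemma AE_unit_iff:
  assumes [measurable]: "f \<in> borel_measurable haar" "g \<in> borel_measurable haar"
  shows "(AE t in lborel. t \<in> circ \<longrightarrow> f (cis t) * star f (cis t) + g (cis t) * star g (cis t) = 1) \<longleftrightarrow>
    (AE z in haar. (cmod (f z))\<^sup>2 + (cmod (g z))\<^sup>2 = 1)"
proof -
  have "{z \<in> space haar. (cmod (f z))\<^sup>2 + (cmod (g z))\<^sup>2 = 1} \<in> sets haar" by measurable
  then show ?thesis by (subst AE_haar_iff) (simp_all add: star_circle norm_sq_sum_eq_1_iff)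
qed

lemma ess_bounded_unit:
  assumes [measurable]: "f \<in> borel_measurable haar" "g \<in> borel_measurable haar"
    and AE: "AE z in haar. (cmod (f z))\<^sup>2 + (cmod (g z))\<^sup>2 = 1"
  shows "AE z in haar. cmod (f z) \<le> 1" "AE z in haar. cmod (g z) \<le> 1" "ess_bounded haar f" "ess_bounded haar g"
proof -
  have *: "\<bar>x\<bar> \<le> 1" if "x\<^sup>2 + y\<^sup>2 = 1" for x y :: real
  proof -
    have "x\<^sup>2 \<le> 1" using that zero_le_power2[of y] by linarith
    then show ?thesis by (simp add: abs_square_le_1)
  qed
  show f: "AE z in haar. cmod (f z) \<le> 1"
    using AE
  proof eventually_elim
    case (elim z)
    then show ?case using *[of "cmod (f z)" "cmod (g z)"] by simp
  qed
  show g: "AE z in haar. cmod (g z) \<le> 1"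
    using AE
  proof eventually_elim
    case (elim z)
    then show ?case using *[of "cmod (g z)" "cmod (f z)"] by simp
  qed
  show "ess_bounded haar f" by (rule ess_boundedI[OF assms(1) f])
  show "ess_bounded haar g" by (rule ess_boundedI[OF assms(2) g])
qed

text \<open>The unit condition bounds both components by 1, so square integrability is automatic.
  Undoing \<open>star\<close> reflects frequencies: \<open>H2Dstar\<close> becomes vanishing of the
  positive coefficients, and the value at infinity becomes the coefficient at 0.\<close>

lemma in_L_iff:
  "in_L p \<longleftrightarrow> fst p \<in> borel_measurable haar \<and> snd p \<in> borel_measurable haar \<and>
     (AE z in haar. (cmod (fst p z))\<^sup>2 + (cmod (snd p z))\<^sup>2 = 1) \<and>
     (\<forall>k>0. fourier (fst p) k = 0) \<and> fourier (fst p) 0 \<in> \<real> \<and> Re (fourier (fst p) 0) > 0"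
  (is "_ \<longleftrightarrow> ?a \<and> ?b \<and> ?n \<and> ?rest")
proof (cases "?a \<and> ?b \<and> ?n")
  case True
  then have a: "?a" and b: "?b" and n: "?n" by auto
  have "AE z in haar. cmod (star (fst p) z) \<le> 1"
    using ess_bounded_unit(1)[OF a b n] AE_space by eventually_elim (simp add: star_circle)
  then have "ess_bounded haar (star (fst p))"
    using a by (intro ess_boundedI) (simp_all add: star_measurable_iff)
  then have "H2Dstar (fst p) \<longleftrightarrow> (\<forall>k<0. cnj (fourier (fst p) (- k)) = 0)"
    unfolding H2Dstar_def by (simp add: H2D_ess_bounded bounded_hardy_def fourier_star[OF a])
  also have "\<dots> \<longleftrightarrow> (\<forall>k>0. fourier (fst p) k = 0)"
    by (metis complex_cnj_zero_iff equation_minus_iff neg_0_less_iff_less)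
  finally show ?thesis
    using a b n unfolding in_L_def AE_unit_iff[OF a b] measurable_haar[symmetric] at_infty_def fourier_star[OF a]
    by simp
next
  case False
  have "\<not> in_L p"
  proof
    assume "in_L p"
    then have "?a \<and> ?b" unfolding in_L_def measurable_haar by auto
    with \<open>in_L p\<close> False show False unfolding in_L_def using AE_unit_iff[of "fst p" "snd p"] by auto
  qed
  with False show ?thesis by blast
qed

lemma in_L_D:
  assumes "in_L p"
  shows "ess_bounded haar (fst p)" "ess_bounded haar (snd p)"
    "AE z in haar. (cmod (fst p z))\<^sup>2 + (cmod (snd p z))\<^sup>2 = 1"
    "AE z in haar. cmod (fst p z) \<le> 1" "AE z in haar. cmod (snd p z) \<le> 1"
    "k > 0 \<Longrightarrow> fourier (fst p) k = 0"
    "fourier (fst p) 0 = of_real (Re (fourier (fst p) 0))" "Re (fourier (fst p) 0) > 0"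
proof -
  note * = assms[unfolded in_L_iff]
  from * have "fst p \<in> borel_measurable haar" "snd p \<in> borel_measurable haar"
    "AE z in haar. (cmod (fst p z))\<^sup>2 + (cmod (snd p z))\<^sup>2 = 1" by blast+
  from this(3) ess_bounded_unit[OF this]
  show "ess_bounded haar (fst p)" "ess_bounded haar (snd p)"
    "AE z in haar. (cmod (fst p z))\<^sup>2 + (cmod (snd p z))\<^sup>2 = 1"
    "AE z in haar. cmod (fst p z) \<le> 1" "AE z in haar. cmod (snd p z) \<le> 1"
    by blast+
  show "k > 0 \<Longrightarrow> fourier (fst p) k = 0" "Re (fourier (fst p) 0) > 0" using * by blast+
  have "fourier (fst p) 0 \<in> \<real>" using * by blast
  then show "fourier (fst p) 0 = of_real (Re (fourier (fst p) 0))" by (rule of_real_Re[symmetric])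
qed

lemma in_Hbar_iff: "in_Hbar p \<longleftrightarrow> in_L p \<and> (\<forall>k<0. fourier (snd p) k = 0)"
  unfolding in_Hbar_def using in_L_D(2)[of p] by (auto simp: H2D_ess_bounded bounded_hardy_def)

lemma at_infty_eq: "fst p \<in> borel_measurable haar \<Longrightarrow> at_infty (fst p) = fourier (fst p) 0"
  by (simp add: at_infty_def fourier_star)

lemma ls_coeff_eq: "fst p \<in> borel_measurable haar \<Longrightarrow> ls_coeff p = fourier (snd p) 0 / cnj (fourier (fst p) 0)"
  by (simp add: ls_coeff_def fourier_star)

text \<open>Only values on the circle carry meaning. Off the circle \<open>star\<close> moves the
  point whereas \<open>layer\<close> merely conjugates, so the identities between pairs are claimed
  at |z| = 1 only.\<close>

definition pair_eq :: "cpair \<Rightarrow> cpair \<Rightarrow> bool" (infix "=\<^sub>T" 50) where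
  "p =\<^sub>T q \<longleftrightarrow> (\<forall>z. cmod z = 1 \<longrightarrow> fst p z = fst q z \<and> snd p z = snd q z)"

lemma pair_eq_ls_coeff: "p =\<^sub>T q \<Longrightarrow> ls_coeff p = ls_coeff q"
  unfolding ls_coeff_def
  by (rule arg_cong2[of _ _ _ _ divide]) (auto simp: pair_eq_def star_circle intro!: fourier_cong)

lemma pair_eq_fourier: "p =\<^sub>T q \<Longrightarrow> fourier (fst p) k = fourier (fst q) k" "p =\<^sub>T q \<Longrightarrow> fourier (snd p) k = fourier (snd q) k"
  by (auto simp: pair_eq_def intro: fourier_cong)

lemma pair_eq_in_L: "p =\<^sub>T q \<Longrightarrow> in_L p \<longleftrightarrow> in_L q"
proof -
  assume pq: "p =\<^sub>T q"
  have "(AE z in haar. (cmod (fst p z))\<^sup>2 + (cmod (snd p z))\<^sup>2 = 1) \<longleftrightarrow> (AE z in haar. (cmod (fst q z))\<^sup>2 + (cmod (snd q z))\<^sup>2 = 1)"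
    using pq by (intro AE_cong) (simp add: pair_eq_def)
  moreover have "fst p \<in> borel_measurable haar \<longleftrightarrow> fst q \<in> borel_measurable haar"
      "snd p \<in> borel_measurable haar \<longleftrightarrow> snd q \<in> borel_measurable haar"
    using pq by (auto simp: pair_eq_def intro!: measurable_haar_cong)
  ultimately show ?thesis
    by (simp only: in_L_iff pair_eq_fourier[OF pq])
qed

lemma pair_eq_in_Hbar: "p =\<^sub>T q \<Longrightarrow> in_Hbar p \<longleftrightarrow> in_Hbar q"
  by (simp add: in_Hbar_iff pair_eq_in_L pair_eq_fourier)

section \<open>A single layer and its removal\<close>

definition normalizer :: "complex \<Rightarrow> real" where
  "normalizer F = 1 / sqrt (1 + (cmod F)\<^sup>2)"

lemma normalizer_pos: "normalizer F > 0" and normalizer_le_1: "normalizer F \<le> 1"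
  by (auto simp: normalizer_def add_pos_nonneg)

lemma normalizer_sq: "(normalizer F)\<^sup>2 * (1 + (cmod F)\<^sup>2) = 1"
proof -
  have "1 + (cmod F)\<^sup>2 > 0" by (simp add: add_pos_nonneg)
  then show ?thesis by (simp add: normalizer_def power_divide)
qed

lemma normalizer_mult: "of_real (normalizer F) * of_real (normalizer F) * (1 + F * cnj F) = 1"
proof -
  have "of_real (normalizer F) * of_real (normalizer F) * (1 + F * cnj F) = complex_of_real ((normalizer F)\<^sup>2 * (1 + (cmod F)\<^sup>2))"
    by (simp add: power2_eq_square complex_norm_square[symmetric])
  then show ?thesis by (simp only: normalizer_sq of_real_1)
qed

text \<open>On the circle, the \<open>pmult\<close> product of the normalised constant pair
  \<open>(1, F)\<close> with \<open>(a, z b)\<close>. Writing \<open>cnj\<close> in place of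
  \<open>star\<close> reduces later identities to pointwise algebra.\<close>

definition layer :: "complex \<Rightarrow> cpair \<Rightarrow> cpair" where
  "layer F q = (\<lambda>z. normalizer F * (fst q z - F * cnj (z * snd q z)),
                \<lambda>z. normalizer F * (z * snd q z + F * cnj (fst q z)))"

text \<open>In the coordinates \<open>(x, cnj y)\<close> the map is complex linear and given by a
  matrix in SU(2).\<close>

lemma rotation_norm:
  "(cmod (normalizer F * (x - F * cnj y)))\<^sup>2 + (cmod (normalizer F * (y + F * cnj x)))\<^sup>2 = (cmod x)\<^sup>2 + (cmod y)\<^sup>2"
proof -
  have "complex_of_real ((cmod (normalizer F * (x - F * cnj y)))\<^sup>2 + (cmod (normalizer F * (y + F * cnj x)))\<^sup>2) =
      (of_real (normalizer F) * of_real (normalizer F) * (1 + F * cnj F)) * (x * cnj x + y * cnj y)"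
    by (simp only: of_real_add complex_norm_square) (simp add: algebra_simps)
  also have "\<dots> = complex_of_real ((cmod x)\<^sup>2 + (cmod y)\<^sup>2)"
    by (simp only: normalizer_mult of_real_add complex_norm_square mult_1_left)
  finally show ?thesis by (simp only: of_real_eq_iff)
qed

text \<open>A layer is real linear, so a difference of images is again a rotated pair; the factor z
  does not change moduli.\<close>

lemma layer_diff_norm:
  assumes "cmod z = 1"
  shows "(cmod (fst (layer F p) z - fst (layer F q) z))\<^sup>2 + (cmod (snd (layer F p) z - snd (layer F q) z))\<^sup>2 =
    (cmod (fst p z - fst q z))\<^sup>2 + (cmod (snd p z - snd q z))\<^sup>2"
proof -
  let ?x = "fst p z - fst q z" and ?y = "z * snd p z - z * snd q z"
  have "fst (layer F p) z - fst (layer F q) z = normalizer F * (?x - F * cnj ?y)"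
    "snd (layer F p) z - snd (layer F q) z = normalizer F * (?y + F * cnj ?x)"
    by (simp_all add: layer_def algebra_simps)
  moreover have "cmod ?y = cmod (snd p z - snd q z)"
    using assms by (simp flip: right_diff_distrib add: norm_mult)
  ultimately show ?thesis by (simp only: rotation_norm)
qed

lemma layer_norm:
  assumes "cmod z = 1"
  shows "(cmod (fst (layer F p) z))\<^sup>2 + (cmod (snd (layer F p) z))\<^sup>2 = (cmod (fst p z))\<^sup>2 + (cmod (snd p z))\<^sup>2"
  using layer_diff_norm[OF assms, of F p "(\<lambda>_. 0, \<lambda>_. 0)"] by (simp add: layer_def)

lemma fourier_rotation:
  assumes "ess_bounded haar f" "ess_bounded haar g"
  shows "fourier (\<lambda>z. c * (f z + d * cnj (g z))) k = c * (fourier f k + d * cnj (fourier g (- k)))"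
    "fourier (\<lambda>z. c * (f z - d * cnj (g z))) k = c * (fourier f k - d * cnj (fourier g (- k)))"
proof -
  note [measurable] = ess_bounded_measurable[OF assms(1)] ess_bounded_measurable[OF assms(2)]
  have "fourier (\<lambda>z. d * cnj (g z)) k = d * fourier (\<lambda>z. cnj (g z)) k" by (rule fourier_scale) measurable
  also have "fourier (\<lambda>z. cnj (g z)) k = cnj (fourier g (- k))" by (rule fourier_cnj) measurable
  finally have g: "fourier (\<lambda>z. d * cnj (g z)) k = d * cnj (fourier g (- k))" .
  have dg: "ess_bounded haar (\<lambda>z. d * cnj (g z))" by (intro ess_bounded_intros assms)
  have "fourier (\<lambda>z. c * (f z + d * cnj (g z))) k = c * fourier (\<lambda>z. f z + d * cnj (g z)) k"
    "fourier (\<lambda>z. c * (f z - d * cnj (g z))) k = c * fourier (\<lambda>z. f z - d * cnj (g z)) k"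
    by (rule fourier_scale, measurable)+
  then show "fourier (\<lambda>z. c * (f z + d * cnj (g z))) k = c * (fourier f k + d * cnj (fourier g (- k)))"
    "fourier (\<lambda>z. c * (f z - d * cnj (g z))) k = c * (fourier f k - d * cnj (fourier g (- k)))"
    by (simp_all only: fourier_add[OF assms(1) dg] fourier_diff[OF assms(1) dg] g)
qed

text \<open>The factor z shifts the index by one and conjugation reflects it, which produces the
  index \<open>- k - 1\<close> in the first component.\<close>

lemma layer_fourier:
  assumes "ess_bounded haar (fst q)" "ess_bounded haar (snd q)"
  shows "fourier (fst (layer F q)) k = normalizer F * (fourier (fst q) k - F * cnj (fourier (snd q) (- k - 1)))"
    "fourier (snd (layer F q)) k = normalizer F * (fourier (snd q) (k - 1) + F * cnj (fourier (fst q) (- k)))"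
    "ess_bounded haar (fst (layer F q))" "ess_bounded haar (snd (layer F q))"
proof -
  note [measurable] = ess_bounded_measurable[OF assms(1)] ess_bounded_measurable[OF assms(2)]
  have z: "ess_bounded haar (\<lambda>z. z)" using ess_bounded_powi[of 1] by simp
  note eb = ess_bounded_intros assms z
  have zq: "ess_bounded haar (\<lambda>z. z * snd q z)" by (intro eb)
  have shift: "fourier (\<lambda>z. z * snd q z) k = fourier (snd q) (k - 1)" for k
    using fourier_shift[of "snd q" 1 k] by simp
  show "fourier (fst (layer F q)) k = normalizer F * (fourier (fst q) k - F * cnj (fourier (snd q) (- k - 1)))"
    unfolding layer_def fst_conv fourier_rotation[OF assms(1) zq] shift ..
  show "fourier (snd (layer F q)) k = normalizer F * (fourier (snd q) (k - 1) + F * cnj (fourier (fst q) (- k)))"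
    unfolding layer_def snd_conv fourier_rotation[OF zq assms(1)] shift ..
  show "ess_bounded haar (fst (layer F q))" "ess_bounded haar (snd (layer F q))"
    unfolding layer_def fst_conv snd_conv by (intro eb)+
qed

lemma ls_step_circle:
  assumes "cmod z = 1"
  shows "fst (ls_step p) z = normalizer (ls_coeff p) * (fst p z + ls_coeff p * cnj (snd p z))"
    "z * snd (ls_step p) z = normalizer (ls_coeff p) * (snd p z - ls_coeff p * cnj (fst p z))"
proof -
  have "z \<noteq> 0" using assms by auto
  show "fst (ls_step p) z = normalizer (ls_coeff p) * (fst p z + ls_coeff p * cnj (snd p z))"
    using assms by (simp add: ls_step_def pmult_def Let_def star_circle normalizer_def[symmetric] ring_distribs mult.assoc)
  have "snd (ls_step p) z = (normalizer (ls_coeff p) * (snd p z - ls_coeff p * cnj (fst p z))) / z"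
    using assms by (simp add: ls_step_def pmult_def Let_def star_circle normalizer_def[symmetric] ring_distribs mult.assoc)
  then show "z * snd (ls_step p) z = normalizer (ls_coeff p) * (snd p z - ls_coeff p * cnj (fst p z))"
    using \<open>z \<noteq> 0\<close> by simp
qed

text \<open>For k >= 0 the index \<open>- k - 1\<close> is negative, where b has no coefficients. So
  a layer keeps the first component free of positive frequencies and multiplies its value at
  infinity by the normalizer. The quotient defining the layer coefficient then returns F, and
  rotating by -F undoes the layer.\<close>

lemma in_Hbar_layer:
  assumes q: "in_Hbar q"
  shows "in_Hbar (layer F q)"
    "fourier (fst (layer F q)) 0 = normalizer F * fourier (fst q) 0"
    "ls_coeff (layer F q) = F"
    "ls_step (layer F q) =\<^sub>T q"
proof -
  have L: "in_L q" and b: "\<And>k. k < 0 \<Longrightarrow> fourier (snd q) k = 0" using q by (auto simp: in_Hbar_iff)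
  note LD = in_L_D[OF L]
  note lf = layer_fourier[OF LD(1,2), of F]
  show a0: "fourier (fst (layer F q)) 0 = normalizer F * fourier (fst q) 0"
    by (simp add: lf b)
  have norm: "AE z in haar. (cmod (fst (layer F q) z))\<^sup>2 + (cmod (snd (layer F q) z))\<^sup>2 = 1"
    using LD(3) AE_space by eventually_elim (simp add: layer_norm)
  show "in_Hbar (layer F q)"
    unfolding in_Hbar_iff in_L_iff
  proof (intro conjI norm allI impI)
    show "fourier (fst (layer F q)) 0 \<in> \<real>" "0 < Re (fourier (fst (layer F q)) 0)"
      using LD(7,8) normalizer_pos[of F] unfolding a0 by (auto simp: complex_is_Real_iff complex_eq_iff)
    show "fourier (fst (layer F q)) k = 0" if "k > 0" for k
      using that by (simp add: lf LD b)
    show "fourier (snd (layer F q)) k = 0" if "k < 0" for k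
      using that by (simp add: lf LD b)
  qed (auto intro: ess_bounded_measurable lf)
  have "fourier (snd (layer F q)) 0 = F * cnj (fourier (fst (layer F q)) 0)"
    unfolding a0 by (simp add: lf b)
  moreover have "fourier (fst (layer F q)) 0 \<noteq> 0"
    unfolding a0 using LD(8) normalizer_pos[of F] by auto
  ultimately show F: "ls_coeff (layer F q) = F"
    by (simp add: ls_coeff_eq ess_bounded_measurable[OF lf(3)])
  show "ls_step (layer F q) =\<^sub>T q"
    unfolding pair_eq_def
  proof (intro allI impI)
    fix z :: complex assume z: "cmod z = 1"
    have z0: "z \<noteq> 0" using z by auto
    let ?c = "complex_of_real (normalizer F)" and ?x = "fst q z" and ?y = "z * snd q z"
    have "fst (ls_step (layer F q)) z = ?c * (?c * (?x - F * cnj ?y) + F * cnj (?c * (?y + F * cnj ?x)))"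
      unfolding ls_step_circle(1)[OF z] F by (simp add: layer_def)
    also have "\<dots> = ?c * ?c * (1 + F * cnj F) * ?x" by (simp add: algebra_simps)
    finally have 1: "fst (ls_step (layer F q)) z = ?x" by (simp only: normalizer_mult mult_1_left)
    have "z * snd (ls_step (layer F q)) z = ?c * (?c * (?y + F * cnj ?x) - F * cnj (?c * (?x - F * cnj ?y)))"
      unfolding ls_step_circle(2)[OF z] F by (simp add: layer_def)
    also have "\<dots> = ?c * ?c * (1 + F * cnj F) * ?y" by (simp add: algebra_simps)
    finally have "z * snd (ls_step (layer F q)) z = ?y" by (simp only: normalizer_mult mult_1_left)
    with 1 z0 show "fst (ls_step (layer F q)) z = ?x \<and> snd (ls_step (layer F q)) z = snd q z" by simp
  qed
qed

text \<open>The coefficient is chosen so that the rotated second component vanishes at 0, which is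
  exactly what allows division by z. Reversing the rotation recovers p as a layer over the stripped
  pair.\<close>

lemma in_Hbar_ls_step:
  assumes p: "in_Hbar p"
  shows "in_Hbar (ls_step p)" "p =\<^sub>T layer (ls_coeff p) (ls_step p)"
    "fourier (fst p) 0 = normalizer (ls_coeff p) * fourier (fst (ls_step p)) 0"
proof -
  define F where "F = ls_coeff p"
  define c where "c = complex_of_real (normalizer F)"
  have c: "c * c * (1 + F * cnj F) = 1" "cnj c = c" by (simp_all add: c_def normalizer_mult)
  have L: "in_L p" and b: "\<And>k. k < 0 \<Longrightarrow> fourier (snd p) k = 0" using p by (auto simp: in_Hbar_iff)
  note LD = in_L_D[OF L]
  note [measurable] = ess_bounded_measurable[OF LD(1)] ess_bounded_measurable[OF LD(2)]
  let ?q = "ls_step p"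
  let ?f = "\<lambda>z. c * (fst p z + F * cnj (snd p z))" and ?g = "\<lambda>z. z powi (- 1) * (c * (snd p z - F * cnj (fst p z)))"
  have f: "fst ?q z = ?f z" and g': "z * snd ?q z = c * (snd p z - F * cnj (fst p z))" if "cmod z = 1" for z
    using ls_step_circle[OF that, of p] by (simp_all add: c_def F_def)
  have g: "snd ?q z = ?g z" if "cmod z = 1" for z
  proof -
    have "z \<noteq> 0" using that by auto
    then show ?thesis unfolding g'[OF that, symmetric] by (simp add: power_int_minus)
  qed
  have meas: "fst ?q \<in> borel_measurable haar" "snd ?q \<in> borel_measurable haar"
  proof -
    have "?f \<in> borel_measurable haar" by measurable
    then show "fst ?q \<in> borel_measurable haar" using measurable_haar_cong[of "fst ?q" ?f, OF f] by blast
    have "?g \<in> borel_measurable haar" by measurable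
    then show "snd ?q \<in> borel_measurable haar" using measurable_haar_cong[of "snd ?q" ?g, OF g] by blast
  qed
  show eq: "p =\<^sub>T layer (ls_coeff p) ?q"
    unfolding pair_eq_def
  proof (intro allI impI)
    fix z assume z: "cmod z = 1"
    have "fst (layer F ?q) z = c * (?f z - F * cnj (c * (snd p z - F * cnj (fst p z))))"
      by (simp only: layer_def fst_conv f[OF z] g'[OF z] c_def)
    also have "\<dots> = c * c * (1 + F * cnj F) * fst p z" by (simp add: c(2) algebra_simps)
    finally have 1: "fst (layer F ?q) z = fst p z" by (simp only: c mult_1_left)
    have "snd (layer F ?q) z = c * (c * (snd p z - F * cnj (fst p z)) + F * cnj (?f z))"
      by (simp only: layer_def snd_conv f[OF z] g'[OF z] c_def)
    also have "\<dots> = c * c * (1 + F * cnj F) * snd p z" by (simp add: c(2) algebra_simps)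
    finally have "snd (layer F ?q) z = snd p z" by (simp only: c mult_1_left)
    with 1 show "fst p z = fst (layer (ls_coeff p) ?q) z \<and> snd p z = snd (layer (ls_coeff p) ?q) z"
      by (simp only: F_def)
  qed
  have norm: "AE z in haar. (cmod (fst ?q z))\<^sup>2 + (cmod (snd ?q z))\<^sup>2 = 1"
    using LD(3) AE_space
  proof eventually_elim
    case (elim z)
    then have z: "cmod z = 1" by simp
    show ?case using layer_norm[OF z, of "ls_coeff p" ?q] elim(1) eq z by (simp add: pair_eq_def)
  qed
  have a': "fourier (fst ?q) k = c * (fourier (fst p) k + F * cnj (fourier (snd p) (- k)))" for k
  proof -
    have "fourier (fst ?q) k = fourier ?f k" by (rule fourier_cong) (rule f)
    also have "\<dots> = c * (fourier (fst p) k + F * cnj (fourier (snd p) (- k)))"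
      by (rule fourier_rotation[OF LD(1,2)])
    finally show ?thesis .
  qed
  have b': "fourier (snd ?q) k = c * (fourier (snd p) (k + 1) - F * cnj (fourier (fst p) (- k - 1)))" for k
  proof -
    have "fourier (snd ?q) k = fourier ?g k" by (rule fourier_cong) (rule g)
    also have "\<dots> = fourier (\<lambda>z. c * (snd p z - F * cnj (fst p z))) (k - (- 1))"
      by (rule fourier_shift) measurable
    also have "\<dots> = c * (fourier (snd p) (k + 1) - F * cnj (fourier (fst p) (- k - 1)))"
      using fourier_rotation(2)[OF LD(2,1), of c F "k + 1"] by simp
    finally show ?thesis .
  qed
  have a0: "fourier (fst p) 0 \<noteq> 0" "cnj (fourier (fst p) 0) = fourier (fst p) 0"
    using LD(7,8) by (auto simp: complex_eq_iff)
  have b0: "fourier (snd p) 0 = F * fourier (fst p) 0"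
    using a0 by (simp add: F_def ls_coeff_eq)
  \<comment> \<open>Substituting \<open>b0\<close> turns the sum into (1 + |F|^2) times the old
    value at infinity, so stripping divides that value by the normalizer.\<close>
  have "c * fourier (fst ?q) 0 = c * c * (1 + F * cnj F) * fourier (fst p) 0"
    by (simp add: a' b0 a0(2) algebra_simps)
  then have A: "fourier (fst p) 0 = c * fourier (fst ?q) 0" by (simp only: c mult_1_left)
  then show "fourier (fst p) 0 = normalizer (ls_coeff p) * fourier (fst ?q) 0" by (simp add: c_def F_def)
  have "c \<noteq> 0" using normalizer_pos[of F] by (auto simp: c_def)
  then have "fourier (fst ?q) 0 = of_real (Re (fourier (fst p) 0) / normalizer F)"
    using A LD(7) by (simp add: c_def field_simps)
  moreover have "Re (fourier (fst p) 0) / normalizer F > 0" using LD(8) normalizer_pos by simp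
  ultimately show "in_Hbar ?q"
    unfolding in_Hbar_iff in_L_iff using meas norm
  proof (intro conjI allI impI)
    show "fourier (fst ?q) k = 0" if "k > 0" for k using that by (simp add: a' LD b)
    show "fourier (snd ?q) k = 0" if "k < 0" for k
    \<comment> \<open>The index -1 is the critical one, where the two terms cancel by the choice of
      F. For smaller k each term vanishes on its own.\<close>
    proof (cases "k = -1")
      case True
      then show ?thesis by (simp add: b' b0 a0(2))
    next
      case False
      then show ?thesis using that by (simp add: b' LD b)
    qed
  qed auto
qed

section \<open>Distances between pairs\<close>

definition one_pair :: cpair where
  "one_pair = (\<lambda>_. 1, \<lambda>_. 0)"

lemma in_Hbar_one_pair: "in_Hbar one_pair" and fourier_one_pair: "fourier (fst one_pair) 0 = 1"
  by (simp_all add: in_Hbar_iff in_L_iff one_pair_def fourier_const)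

text \<open>A squared L^2 distance on pairs. Summing both squared norms before any root is taken
  makes it exactly invariant under layers, which \<open>rho\<close> need not be.\<close>

definition pair_dist :: "cpair \<Rightarrow> cpair \<Rightarrow> real" where
  "pair_dist p q = (\<integral>z. (cmod (fst p z - fst q z))\<^sup>2 + (cmod (snd p z - snd q z))\<^sup>2 \<partial>haar)"

lemma pair_dist_commute: "pair_dist p q = pair_dist q p"
  by (simp add: pair_dist_def norm_minus_commute)

lemma pair_dist_layer: "pair_dist (layer F p) (layer F q) = pair_dist p q"
  unfolding pair_dist_def by (rule Bochner_Integration.integral_cong) (simp_all add: layer_diff_norm)

lemma pair_dist_cong: "p =\<^sub>T p' \<Longrightarrow> q =\<^sub>T q' \<Longrightarrow> pair_dist p q = pair_dist p' q'"
  unfolding pair_dist_def by (rule Bochner_Integration.integral_cong) (simp_all add: pair_eq_def)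

text \<open>Expanding |a - 1|^2 + |b|^2 and using the unit condition leaves 2 - 2 Re a, which is
  then integrated.\<close>

lemma pair_dist_one_pair:
  assumes "in_L q"
  shows "pair_dist q one_pair = 2 - 2 * Re (fourier (fst q) 0)"
proof -
  note LD = in_L_D[OF assms]
  note [measurable] = ess_bounded_measurable[OF LD(1)] ess_bounded_measurable[OF LD(2)]
  have "pair_dist q one_pair = (\<integral>z. 2 - 2 * Re (fst q z) \<partial>haar)"
    unfolding pair_dist_def
  proof (rule integral_cong_AE)
    show "AE z in haar. (cmod (fst q z - fst one_pair z))\<^sup>2 + (cmod (snd q z - snd one_pair z))\<^sup>2 = 2 - 2 * Re (fst q z)"
      using LD(3) by eventually_elim (simp add: one_pair_def cmod_diff_sq)
  qed (simp_all add: one_pair_def)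
  also have "\<dots> = 2 - 2 * Re (\<integral>z. fst q z \<partial>haar)"
    using haar.ess_bounded_integrable[OF LD(1)] haar.prob_space by simp
  also have "(\<integral>z. fst q z \<partial>haar) = fourier (fst q) 0"
    by (simp add: fourier_haar)
  finally show ?thesis .
qed

section \<open>Partial products as iterated layers\<close>

lemma nlfs_partial_circle:
  fixes F :: "int \<Rightarrow> complex"
  assumes "cmod z = 1"
  shows "fst (nlfs_partial F 0) z = normalizer (F 0)" "snd (nlfs_partial F 0) z = normalizer (F 0) * F 0"
    "fst (nlfs_partial F (Suc k)) z = normalizer (F (int (Suc k))) *
       (fst (nlfs_partial F k) z - snd (nlfs_partial F k) z * cnj (F (int (Suc k)) * z ^ Suc k))"
    "snd (nlfs_partial F (Suc k)) z = normalizer (F (int (Suc k))) *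
       (fst (nlfs_partial F k) z * (F (int (Suc k)) * z ^ Suc k) + snd (nlfs_partial F k) z)"
  using assms
  by (simp_all del: power_Suc of_nat_Suc add: Let_def pmult_def star_circle normalizer_def[symmetric] algebra_simps)

lemma nlfs_partial_0: "nlfs_partial F 0 =\<^sub>T layer (F 0) one_pair"
  unfolding pair_eq_def by (auto simp: nlfs_partial_circle layer_def one_pair_def simp del: nlfs_partial.simps)

lemma unimodular_mult_cnj: "cmod z = 1 \<Longrightarrow> z * cnj z = 1"
  by (simp add: complex_norm_square[symmetric])

text \<open>The recursion appends factors on the right, whereas stripping removes them on the left.
  This is the associativity that reconciles both: the extra power of z in every later factor is
  supplied by the z inside \<open>layer\<close>.\<close>

lemma nlfs_partial_shift: "nlfs_partial F (Suc k) =\<^sub>T layer (F 0) (nlfs_partial (\<lambda>n. F (n + 1)) k)"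
  unfolding pair_eq_def
proof (intro allI impI)
  fix z :: complex assume z: "cmod z = 1"
  have zz: "z * cnj z = 1" using z by (rule unimodular_mult_cnj)
  show "fst (nlfs_partial F (Suc k)) z = fst (layer (F 0) (nlfs_partial (\<lambda>n. F (n + 1)) k)) z \<and>
      snd (nlfs_partial F (Suc k)) z = snd (layer (F 0) (nlfs_partial (\<lambda>n. F (n + 1)) k)) z"
  proof (induction k)
    case 0
    show ?case
      by (simp del: nlfs_partial.simps add: nlfs_partial_circle[OF z] layer_def algebra_simps)
  next
    case (Suc k)
    define x where "x = fst (nlfs_partial (\<lambda>n. F (n + 1)) k) z"
    define y where "y = snd (nlfs_partial (\<lambda>n. F (n + 1)) k) z"
    define G where "G = F (int (Suc (Suc k)))"
    define u where "u = z ^ Suc k"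
    define c where "c = complex_of_real (normalizer G)"
    define d where "d = complex_of_real (normalizer (F 0))"
    have G: "F (int (Suc k) + 1) = G" by (simp add: G_def algebra_simps)
    have u: "z ^ Suc (Suc k) = z * u" by (simp add: u_def)
    note IH = Suc.IH[unfolded layer_def fst_conv snd_conv, folded x_def y_def d_def]
    have "fst (nlfs_partial F (Suc (Suc k))) z = c * (d * (x - F 0 * cnj (z * y)) - d * (z * y + F 0 * cnj x) * cnj (G * (z * u)))"
      "snd (nlfs_partial F (Suc (Suc k))) z = c * (d * (x - F 0 * cnj (z * y)) * (G * (z * u)) + d * (z * y + F 0 * cnj x))"
      unfolding nlfs_partial_circle(3,4)[OF z, of F "Suc k"] IH[THEN conjunct1] IH[THEN conjunct2] u
      by (simp_all only: G_def[symmetric] c_def)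
    moreover have "fst (layer (F 0) (nlfs_partial (\<lambda>n. F (n + 1)) (Suc k))) z =
        d * (c * (x - y * cnj (G * u)) - F 0 * cnj (z * (c * (x * (G * u) + y))))"
      "snd (layer (F 0) (nlfs_partial (\<lambda>n. F (n + 1)) (Suc k))) z =
        d * (z * (c * (x * (G * u) + y)) + F 0 * cnj (c * (x - y * cnj (G * u))))"
      unfolding layer_def fst_conv snd_conv nlfs_partial_circle(3,4)[OF z, of _ k]
      by (simp_all only: G x_def y_def u_def c_def d_def)
    moreover have "cnj c = c" by (simp add: c_def)
    \<comment> \<open>What remains is a polynomial identity modulo \<open>z * cnj z = 1\<close> and
      the reality of c.\<close>
    ultimately show ?case
      using zz by (simp only: complex_cnj_mult complex_cnj_add complex_cnj_diff complex_cnj_cnj) (intro conjI; algebra)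
  qed
qed

text \<open>Each claim follows from its analogue for a single outermost layer, so the induction runs
  over all sequences at once and applies its hypothesis to the shifted one.\<close>

lemma nlfs_partial_in_Hbar:
  "in_Hbar (nlfs_partial F k) \<and>
    fourier (fst (nlfs_partial F k)) 0 = of_real (\<Prod>j\<le>k. normalizer (F (int j))) \<and>
    ls_coeff (nlfs_partial F k) = F 0"
proof (induction k arbitrary: F)
  case 0
  note * = in_Hbar_layer[OF in_Hbar_one_pair, of "F 0"]
  note eq = nlfs_partial_0[of F]
  show ?case
    using * fourier_one_pair
    by (simp del: nlfs_partial.simps add: pair_eq_in_Hbar[OF eq] pair_eq_fourier[OF eq] pair_eq_ls_coeff[OF eq])
next
  case (Suc k)
  note IH = Suc[of "\<lambda>n. F (n + 1)"]
  note * = in_Hbar_layer[OF IH[THEN conjunct1], of "F 0"]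
  note eq = nlfs_partial_shift[of F k]
  have "of_real (normalizer (F 0)) * of_real (\<Prod>j\<le>k. normalizer (F (int j + 1))) =
      complex_of_real (\<Prod>j\<le>Suc k. normalizer (F (int j)))"
    by (simp only: prod.atMost_Suc_shift of_real_mult) (simp add: add.commute)
  then show ?case
    using * IH
    by (simp del: nlfs_partial.simps prod.atMost_Suc add: pair_eq_in_Hbar[OF eq] pair_eq_fourier[OF eq] pair_eq_ls_coeff[OF eq])
qed

text \<open>Both products share their first k + 1 layers. Removing these leaves the distance from a
  product of n + 1 later factors to \<open>(1, 0)\<close>, which its value at infinity
  determines.\<close>

lemma pair_dist_nlfs_partial:
  "pair_dist (nlfs_partial F (k + Suc n)) (nlfs_partial F k) =
    2 - 2 * (\<Prod>j\<le>n. normalizer (F (int (Suc k + j))))"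
proof (induction k arbitrary: F)
  case 0
  note N = nlfs_partial_in_Hbar[of "\<lambda>m. F (m + 1)" n]
  have "pair_dist (nlfs_partial F (Suc n)) (nlfs_partial F 0) = pair_dist (nlfs_partial (\<lambda>m. F (m + 1)) n) one_pair"
    using pair_dist_cong[OF nlfs_partial_shift nlfs_partial_0, of F n F]
    by (simp only: pair_dist_layer)
  also have "\<dots> = 2 - 2 * Re (fourier (fst (nlfs_partial (\<lambda>m. F (m + 1)) n)) 0)"
    using N by (intro pair_dist_one_pair) (simp add: in_Hbar_iff)
  finally show ?case using N by (simp del: nlfs_partial.simps of_real_prod add: add.commute)
next
  case (Suc k)
  have "pair_dist (nlfs_partial F (Suc (k + Suc n))) (nlfs_partial F (Suc k)) =
      pair_dist (nlfs_partial (\<lambda>m. F (m + 1)) (k + Suc n)) (nlfs_partial (\<lambda>m. F (m + 1)) k)"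
    using pair_dist_cong[OF nlfs_partial_shift nlfs_partial_shift, of F "k + Suc n" F k]
    by (simp only: pair_dist_layer)
  also have "\<dots> = 2 - 2 * (\<Prod>j\<le>n. normalizer (F (int (Suc k + j) + 1)))"
    by (rule Suc)
  finally have *: "pair_dist (nlfs_partial F (Suc (k + Suc n))) (nlfs_partial F (Suc k)) =
      2 - 2 * (\<Prod>j\<le>n. normalizer (F (int (Suc k + j) + 1)))" .
  have "int (Suc k + j) + 1 = int (Suc (Suc k) + j)" for j by simp
  with * show ?case by (simp only: add_Suc)
qed

section \<open>Distance from a pair to the products of its stripped layers\<close>

lemma ls_pairs_step: "ls_pairs (ls_step p) n = ls_pairs p (Suc n)"
  by (induction n) auto

lemma ls_seq_Suc: "ls_seq p (Suc n) = ls_seq (ls_step p) n"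
  by (simp only: ls_seq_def ls_pairs_step)

lemma in_Hbar_ls_pairs: "in_Hbar p \<Longrightarrow> in_Hbar (ls_pairs p n)"
  by (induction n) (auto intro: in_Hbar_ls_step)

text \<open>The partial product with index k has k + 1 factors, all of which are layers of p as
  well. Stripping them compares the pair with index \<open>Suc k\<close> to
  \<open>(1, 0)\<close>.\<close>

lemma pair_dist_nlfs_ls_seq:
  assumes "in_Hbar p" "\<And>j. F (int j) = ls_seq p j"
  shows "pair_dist p (nlfs_partial F k) = 2 - 2 * Re (fourier (fst (ls_pairs p (Suc k))) 0)"
  using assms
proof (induction k arbitrary: p F)
  case 0
  have F: "F 0 = ls_coeff p" using 0(2)[of 0] by (simp add: ls_seq_def)
  have "pair_dist p (nlfs_partial F 0) = pair_dist (ls_step p) one_pair"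
    using pair_dist_cong[OF in_Hbar_ls_step(2)[OF 0(1)] nlfs_partial_0[of F]]
    by (simp only: F pair_dist_layer)
  also have "\<dots> = 2 - 2 * Re (fourier (fst (ls_step p)) 0)"
    using in_Hbar_ls_step(1)[OF 0(1)] by (intro pair_dist_one_pair) (simp add: in_Hbar_iff)
  finally show ?case by simp
next
  case (Suc k)
  have F: "F 0 = ls_coeff p" using Suc(3)[of 0] by (simp add: ls_seq_def)
  have "pair_dist p (nlfs_partial F (Suc k)) = pair_dist (ls_step p) (nlfs_partial (\<lambda>m. F (m + 1)) k)"
    using pair_dist_cong[OF in_Hbar_ls_step(2)[OF Suc(2)] nlfs_partial_shift[of F k]]
    by (simp only: F pair_dist_layer)
  also have "\<dots> = 2 - 2 * Re (fourier (fst (ls_pairs (ls_step p) (Suc k))) 0)"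
  proof (rule Suc.IH)
    show "F (int j + 1) = ls_seq (ls_step p) j" for j
      using Suc(3)[of "Suc j"] by (simp add: ls_seq_Suc add.commute)
  qed (rule in_Hbar_ls_step(1)[OF Suc(2)])
  finally show ?case by (simp only: ls_pairs_step)
qed

section \<open>Convergence of nonlinear Fourier series\<close>

lemma pair_dist_split:
  assumes "in_L p" "in_L q"
  shows "pair_dist p q = (\<integral>z. (cmod (fst p z - fst q z))\<^sup>2 \<partial>haar) + (\<integral>z. (cmod (snd p z - snd q z))\<^sup>2 \<partial>haar)"
  unfolding pair_dist_def
  by (intro Bochner_Integration.integral_add haar.ess_bounded_integrable2 ess_bounded_diff in_L_D assms)

lemma rho_haar:
  assumes "in_L p" "in_L q"
  shows "rho p q = sqrt (\<integral>z. (cmod (fst p z - fst q z))\<^sup>2 \<partial>haar) + sqrt (\<integral>z. (cmod (snd p z - snd q z))\<^sup>2 \<partial>haar) +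
    \<bar>ln (Re (fourier (fst p) 0)) - ln (Re (fourier (fst q) 0))\<bar>"
  using assms[THEN in_L_D(1), THEN ess_bounded_measurable] assms[THEN in_L_D(2), THEN ess_bounded_measurable]
  by (simp add: rho_def L2dist_haar at_infty_eq)

text \<open>A Fourier coefficient of a difference is bounded by its L^2 norm, hence by the root of
  the distance.\<close>

lemma pair_dist_tendsto_fourier:
  assumes P: "\<And>k. in_L (P k)" and p: "in_L p" and lim: "(\<lambda>k. pair_dist (P k) p) \<longlonglongrightarrow> 0"
  shows "(\<lambda>k. fourier (fst (P k)) j) \<longlonglongrightarrow> fourier (fst p) j"
    "(\<lambda>k. fourier (snd (P k)) j) \<longlonglongrightarrow> fourier (snd p) j"
proof -
  have sqrt: "(\<lambda>k. sqrt (pair_dist (P k) p)) \<longlonglongrightarrow> 0"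
    using tendsto_real_sqrt[OF lim] by simp
  have "cmod (fourier (fst (P k)) j - fourier (fst p) j) \<le> sqrt (pair_dist (P k) p)" for k
  proof -
    have "cmod (fourier (fst (P k)) j - fourier (fst p) j) = cmod (fourier (\<lambda>z. fst (P k) z - fst p z) j)"
      by (simp only: fourier_diff[OF in_L_D(1)[OF P] in_L_D(1)[OF p]])
    also have "\<dots> \<le> sqrt (\<integral>z. (cmod (fst (P k) z - fst p z))\<^sup>2 \<partial>haar)"
      by (intro norm_fourier_le_L2 ess_bounded_diff in_L_D P p)
    also have "\<dots> \<le> sqrt (pair_dist (P k) p)"
      unfolding pair_dist_split[OF P p] by (simp add: integral_nonneg_AE)
    finally show ?thesis .
  qed
  then show "(\<lambda>k. fourier (fst (P k)) j) \<longlonglongrightarrow> fourier (fst p) j"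
    by (intro LIM_zero_cancel[OF Lim_null_comparison[OF _ sqrt]]) simp
  have "cmod (fourier (snd (P k)) j - fourier (snd p) j) \<le> sqrt (pair_dist (P k) p)" for k
  proof -
    have "cmod (fourier (snd (P k)) j - fourier (snd p) j) = cmod (fourier (\<lambda>z. snd (P k) z - snd p z) j)"
      by (simp only: fourier_diff[OF in_L_D(2)[OF P] in_L_D(2)[OF p]])
    also have "\<dots> \<le> sqrt (\<integral>z. (cmod (snd (P k) z - snd p z))\<^sup>2 \<partial>haar)"
      by (intro norm_fourier_le_L2 ess_bounded_diff in_L_D P p)
    also have "\<dots> \<le> sqrt (pair_dist (P k) p)"
      unfolding pair_dist_split[OF P p] by (simp add: integral_nonneg_AE)
    finally show ?thesis .
  qed
  then show "(\<lambda>k. fourier (snd (P k)) j) \<longlonglongrightarrow> fourier (snd p) j"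
    by (intro LIM_zero_cancel[OF Lim_null_comparison[OF _ sqrt]]) simp
qed

text \<open>The logarithmic term follows from the others: the value at infinity is a Fourier
  coefficient, so it converges, and its limit is positive, where the logarithm is
  continuous.\<close>

lemma rho_tendsto_iff:
  assumes P: "\<And>k. in_L (P k)" and p: "in_L p"
  shows "(\<lambda>k. rho (P k) p) \<longlonglongrightarrow> 0 \<longleftrightarrow> (\<lambda>k. pair_dist (P k) p) \<longlonglongrightarrow> 0"
proof -
  define u where "u k = (\<integral>z. (cmod (fst (P k) z - fst p z))\<^sup>2 \<partial>haar)" for k
  define v where "v k = (\<integral>z. (cmod (snd (P k) z - snd p z))\<^sup>2 \<partial>haar)" for k
  define w where "w k = \<bar>ln (Re (fourier (fst (P k)) 0)) - ln (Re (fourier (fst p) 0))\<bar>" for k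
  have nonneg: "u k \<ge> 0" "v k \<ge> 0" "w k \<ge> 0" for k by (simp_all add: u_def v_def w_def integral_nonneg_AE)
  have rho: "rho (P k) p = sqrt (u k) + sqrt (v k) + w k" for k
    by (simp add: rho_haar P p u_def v_def w_def)
  have dist: "pair_dist (P k) p = u k + v k" for k
    by (simp add: pair_dist_split P p u_def v_def)
  show ?thesis
  proof
    assume lim: "(\<lambda>k. rho (P k) p) \<longlonglongrightarrow> 0"
    have "(\<lambda>k. sqrt (u k)) \<longlonglongrightarrow> 0" "(\<lambda>k. sqrt (v k)) \<longlonglongrightarrow> 0"
      by (rule tendsto_sandwich[OF _ _ tendsto_const lim]; use nonneg in \<open>simp add: rho\<close>)+
    from tendsto_power[OF this(1), of 2] tendsto_power[OF this(2), of 2]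
    have "(\<lambda>k. u k + v k) \<longlonglongrightarrow> 0 + 0"
      using nonneg by (intro tendsto_add) simp_all
    then show "(\<lambda>k. pair_dist (P k) p) \<longlonglongrightarrow> 0" by (simp add: dist)
  next
    assume lim: "(\<lambda>k. pair_dist (P k) p) \<longlonglongrightarrow> 0"
    have "u \<longlonglongrightarrow> 0" "v \<longlonglongrightarrow> 0"
      by (rule tendsto_sandwich[OF _ _ tendsto_const lim]; use nonneg in \<open>simp add: dist\<close>)+
    then have "(\<lambda>k. sqrt (u k)) \<longlonglongrightarrow> 0" "(\<lambda>k. sqrt (v k)) \<longlonglongrightarrow> 0"
      using tendsto_real_sqrt by fastforce+
    moreover have "w \<longlonglongrightarrow> 0"
    proof -
      have "(\<lambda>k. Re (fourier (fst (P k)) 0)) \<longlonglongrightarrow> Re (fourier (fst p) 0)"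
        by (intro tendsto_Re pair_dist_tendsto_fourier[OF P p lim])
      then have "(\<lambda>k. ln (Re (fourier (fst (P k)) 0)) - ln (Re (fourier (fst p) 0))) \<longlonglongrightarrow> 0"
        using in_L_D(8)[OF p] by (intro LIM_zero tendsto_ln) auto
      then show ?thesis unfolding w_def by (rule tendsto_rabs_zero)
    qed
    ultimately have "(\<lambda>k. sqrt (u k) + sqrt (v k) + w k) \<longlonglongrightarrow> 0 + 0 + 0" by (intro tendsto_add)
    then show "(\<lambda>k. rho (P k) p) \<longlonglongrightarrow> 0" by (simp add: rho)
  qed
qed

lemma nlfs_partial_in_L: "in_L (nlfs_partial F k)"
  using nlfs_partial_in_Hbar[of F k] by (simp add: in_Hbar_iff)

lemma is_NLFS_iff: "is_NLFS F p \<longleftrightarrow> in_L p \<and> (\<lambda>k. pair_dist (nlfs_partial F k) p) \<longlonglongrightarrow> 0"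
  unfolding is_NLFS_def using rho_tendsto_iff[of "nlfs_partial F" p, OF nlfs_partial_in_L] by blast

lemma fourier_ls_pairs:
  assumes "in_Hbar p"
  shows "fourier (fst p) 0 = of_real (\<Prod>j<n. normalizer (ls_seq p j)) * fourier (fst (ls_pairs p n)) 0"
proof (induction n)
  case (Suc n)
  then show ?case
    using in_Hbar_ls_step(3)[OF in_Hbar_ls_pairs[OF assms, of n]] by (simp add: ls_seq_def)
qed simp

text \<open>Fourier coefficients pass to the limit. Thus b inherits the vanishing of negative
  coefficients, and the relation between the constant coefficients of the partial products fixes the
  layer coefficient of the limit.\<close>

lemma is_NLFS_step:
  assumes "is_NLFS F p"
  shows "in_Hbar p" "ls_coeff p = F 0" "is_NLFS (\<lambda>n. F (n + 1)) (ls_step p)"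
    "(\<lambda>k. \<Prod>j\<le>k. normalizer (F (int j))) \<longlonglongrightarrow> Re (fourier (fst p) 0)"
proof -
  have p: "in_L p" and lim: "(\<lambda>k. pair_dist (nlfs_partial F k) p) \<longlonglongrightarrow> 0"
    using assms by (auto simp: is_NLFS_iff)
  note LD = in_L_D[OF p]
  note conv = pair_dist_tendsto_fourier[OF nlfs_partial_in_L p lim]
  note N = nlfs_partial_in_Hbar[of F]
  have "fourier (snd p) k = 0" if "k < 0" for k
  proof -
    have "(\<lambda>n. fourier (snd (nlfs_partial F n)) k) = (\<lambda>n. 0)"
      using N that by (auto simp: in_Hbar_iff)
    with conv(2)[of k] show ?thesis by (simp add: LIMSEQ_const_iff)
  qed
  with p show H: "in_Hbar p" by (simp add: in_Hbar_iff)
  have a0: "fourier (fst p) 0 \<noteq> 0" using LD(8) by auto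
  have "fourier (snd (nlfs_partial F n)) 0 = F 0 * cnj (fourier (fst (nlfs_partial F n)) 0)" for n
  proof -
    note Ln = in_L_D[OF nlfs_partial_in_L[of F n]]
    have "fourier (fst (nlfs_partial F n)) 0 \<noteq> 0" using Ln(8) by auto
    then show ?thesis
      using N[of n] by (auto simp: ls_coeff_eq ess_bounded_measurable[OF Ln(1)] field_simps simp del: nlfs_partial.simps)
  qed
  then have "(\<lambda>n. fourier (snd (nlfs_partial F n)) 0) \<longlonglongrightarrow> F 0 * cnj (fourier (fst p) 0)"
    using tendsto_mult[OF tendsto_const tendsto_cnj[OF conv(1)[of 0]], of "F 0"] by (simp only:)
  with conv(2)[of 0] have "fourier (snd p) 0 = F 0 * cnj (fourier (fst p) 0)" by (rule LIMSEQ_unique)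
  then show F: "ls_coeff p = F 0" using a0 by (simp add: ls_coeff_eq ess_bounded_measurable[OF LD(1)])
  \<comment> \<open>Since the layer coefficient of p is \<open>F 0\<close>, both pairs have the same
    outermost layer, and removing it preserves the distance.\<close>
  have "pair_dist (nlfs_partial F (Suc k)) p = pair_dist (nlfs_partial (\<lambda>n. F (n + 1)) k) (ls_step p)" for k
    using pair_dist_cong[OF nlfs_partial_shift in_Hbar_ls_step(2)[OF H], of F k]
    by (simp only: F pair_dist_layer)
  then have "(\<lambda>k. pair_dist (nlfs_partial (\<lambda>n. F (n + 1)) k) (ls_step p)) \<longlonglongrightarrow> 0"
    using LIMSEQ_Suc[OF lim] by (simp only:)
  then show "is_NLFS (\<lambda>n. F (n + 1)) (ls_step p)"
    using in_Hbar_ls_step(1)[OF H] by (simp add: is_NLFS_iff in_Hbar_iff)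
  show "(\<lambda>k. \<Prod>j\<le>k. normalizer (F (int j))) \<longlonglongrightarrow> Re (fourier (fst p) 0)"
    using tendsto_Re[OF conv(1)[of 0]] N by (simp del: of_real_prod nlfs_partial.simps)
qed

text \<open>Stripping one layer shifts both sequences, which reduces every index to the first
  coefficient.\<close>

lemma ls_seq_NLFS:
  assumes "is_NLFS F p"
  shows "ls_seq p n = F (int n)"
  using assms
proof (induction n arbitrary: F p)
  case 0
  then show ?case using is_NLFS_step(2) by (simp add: ls_seq_def)
next
  case (Suc n)
  then show ?case using Suc.IH[OF is_NLFS_step(3)[OF Suc.prems]] by (simp add: ls_seq_Suc add.commute)
qed

text \<open>The value at infinity after stripping is that of p divided by a product of normalizers,
  and these products tend to that same positive value.\<close>

lemma fourier_ls_pairs_NLFS_tendsto_1: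
  assumes "is_NLFS F p"
  shows "(\<lambda>n. Re (fourier (fst (ls_pairs p (Suc n))) 0)) \<longlonglongrightarrow> 1"
proof -
  note step = is_NLFS_step[OF assms]
  let ?a = "Re (fourier (fst p) 0)" and ?Q = "\<lambda>n. \<Prod>j\<le>n. normalizer (F (int j))"
  have "?a > 0" using step(1) in_L_D(8) by (simp add: in_Hbar_iff)
  then have "(\<lambda>n. ?a / ?Q n) \<longlonglongrightarrow> ?a / ?a" by (intro tendsto_intros step(4)) simp
  moreover have "Re (fourier (fst (ls_pairs p (Suc n))) 0) = ?a / ?Q n" for n
  proof -
    have "?a = ?Q n * Re (fourier (fst (ls_pairs p (Suc n))) 0)"
      using arg_cong[OF fourier_ls_pairs[OF step(1), of "Suc n"], of Re]
      by (simp del: of_real_prod ls_pairs.simps add: ls_seq_NLFS[OF assms] lessThan_Suc_atMost)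
    moreover have "?Q n > 0" by (intro prod_pos normalizer_pos)
    ultimately show ?thesis by (metis less_irrefl nonzero_mult_div_cancel_left)
  qed
  ultimately show ?thesis using \<open>?a > 0\<close> by simp
qed

section \<open>Common inner divisors\<close>

lemma bounded_hardy_add: "bounded_hardy f \<Longrightarrow> bounded_hardy g \<Longrightarrow> bounded_hardy (\<lambda>z. f z + g z)"
  by (simp add: bounded_hardy_def ess_bounded_add fourier_add)

lemma bounded_hardy_diff: "bounded_hardy f \<Longrightarrow> bounded_hardy g \<Longrightarrow> bounded_hardy (\<lambda>z. f z - g z)"
  by (simp add: bounded_hardy_def ess_bounded_diff fourier_diff)

lemma bounded_hardy_scale: "bounded_hardy f \<Longrightarrow> bounded_hardy (\<lambda>z. c * f z)"
  by (auto simp: bounded_hardy_def fourier_scale[OF ess_bounded_measurable] intro: ess_bounded_intros)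

lemma ess_bounded_cong_AE:
  assumes "ess_bounded M f" "g \<in> borel_measurable M" "AE x in M. f x = g x"
  shows "ess_bounded M g"
proof -
  obtain C where "AE x in M. cmod (f x) \<le> C" using assms(1) by (auto simp: ess_bounded_def)
  then have "AE x in M. cmod (g x) \<le> C" using assms(3) by eventually_elim simp
  with assms(2) show ?thesis by (rule ess_boundedI)
qed

lemma bounded_hardy_cong_AE:
  assumes "bounded_hardy f" "g \<in> borel_measurable haar" "AE z in haar. f z = g z"
  shows "bounded_hardy g"
proof -
  have f: "ess_bounded haar f" "\<And>k. k < 0 \<Longrightarrow> fourier f k = 0" using assms(1) by (auto simp: bounded_hardy_def)
  have "fourier g k = fourier f k" for k
    by (rule fourier_cong_AE[OF ess_bounded_measurable[OF f(1)] assms(2,3), symmetric])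
  then show ?thesis using ess_bounded_cong_AE[OF f(1) assms(2,3)] f(2) by (simp add: bounded_hardy_def)
qed

lemma bounded_hardy_cong:
  assumes "bounded_hardy f" "\<And>z. cmod z = 1 \<Longrightarrow> f z = g z"
  shows "bounded_hardy g"
proof (rule bounded_hardy_cong_AE[OF assms(1)])
  have "f \<in> borel_measurable haar" using assms(1) by (auto simp: bounded_hardy_def ess_bounded_def)
  then show "g \<in> borel_measurable haar" using measurable_haar_cong[of f g, OF assms(2)] by blast
  show "AE z in haar. f z = g z" using assms(2) by (intro AE_I2) simp
qed

lemma inner_fun_iff: "inner_fun g \<longleftrightarrow> bounded_hardy g \<and> (AE z in haar. cmod (g z) = 1)"
proof (cases "g \<in> borel_measurable haar")
  case True
  then have [measurable]: "g \<in> borel_measurable haar" .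
  have "{z \<in> space haar. cmod (g z) = 1} \<in> sets haar" by measurable
  then have AE: "(AE t in lborel. t \<in> circ \<longrightarrow> cmod (g (cis t)) = 1) \<longleftrightarrow> (AE z in haar. cmod (g z) = 1)"
    by (subst AE_haar_iff) simp_all
  have "ess_bounded haar g" if "AE z in haar. cmod (g z) = 1"
  proof (rule ess_boundedI[OF True])
    show "AE z in haar. cmod (g z) \<le> 1" using that by eventually_elim simp
  qed
  then show ?thesis unfolding inner_fun_def AE using H2D_ess_bounded by blast
next
  case False
  then show ?thesis
    by (auto simp: inner_fun_def H2D_def L2T_haar bounded_hardy_def dest: ess_bounded_measurable)
qed

lemma const_on_T_iff:
  assumes [measurable]: "g \<in> borel_measurable haar"
  shows "const_on_T g \<longleftrightarrow> (\<exists>c. AE z in haar. g z = c)"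
proof -
  have "(AE z in haar. g z = c) \<longleftrightarrow> (AE t in lborel. t \<in> circ \<longrightarrow> g (cis t) = c)" for c
  proof (rule AE_haar_iff)
    have "{z \<in> space haar. g z = c} \<in> sets haar" by measurable
    then show "{z \<in> circle. g z = c} \<in> sets haar" by simp
  qed
  then show ?thesis by (simp add: const_on_T_def)
qed

text \<open>Cancellation is claimed only almost everywhere, since g may vanish on a null set, where
  the quotient is 0 by convention.\<close>

lemma AE_quotient_mult:
  fixes g :: "'a \<Rightarrow> complex"
  assumes "AE z in M. cmod (g z) = 1"
  shows "AE z in M. f z / g z * g z = f z"
  using assms by eventually_elim auto

text \<open>The factor \<open>z\<close> that stripping removes from \<open>b\<close> is harmless because \<open>g(0) \<noteq> 0\<close>.\<close>

lemma ls_step_divisor: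
  assumes p: "in_Hbar p" and g: "bounded_hardy g" and unit: "AE z in haar. cmod (g z) = 1" and g0: "fourier g 0 \<noteq> 0"
    and a: "bounded_hardy (\<lambda>z. star (fst p) z / g z)" and b: "bounded_hardy (\<lambda>z. snd p z / g z)"
  shows "bounded_hardy (\<lambda>z. star (fst (ls_step p)) z / g z)" "bounded_hardy (\<lambda>z. snd (ls_step p) z / g z)"
proof -
  define F where "F = ls_coeff p"
  have q: "in_Hbar (ls_step p)" by (rule in_Hbar_ls_step(1)[OF p])
  then have "in_L (ls_step p)" and q0: "\<And>k. k < 0 \<Longrightarrow> fourier (snd (ls_step p)) k = 0" by (auto simp: in_Hbar_iff)
  note LD = in_L_D[OF this(1)]
  note [measurable] = ess_bounded_measurable[OF LD(2)]
  have [measurable]: "g \<in> borel_measurable haar" using g by (auto simp: bounded_hardy_def ess_bounded_def)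
  show "bounded_hardy (\<lambda>z. star (fst (ls_step p)) z / g z)"
  proof (rule bounded_hardy_cong)
    show "bounded_hardy (\<lambda>z. normalizer F * (star (fst p) z / g z + cnj F * (snd p z / g z)))"
      by (intro bounded_hardy_scale bounded_hardy_add a b)
    show "normalizer F * (star (fst p) z / g z + cnj F * (snd p z / g z)) = star (fst (ls_step p)) z / g z" if "cmod z = 1" for z
      using that by (simp add: star_circle ls_step_circle F_def add_divide_distrib distrib_left)
  qed
  \<comment> \<open>The quotient before z is removed. It combines the two given quotients linearly,
    so it is in H^infinity; what has to be shown is that it vanishes at 0.\<close>
  define m where "m z = z * (snd (ls_step p) z / g z)" for z
  have m: "bounded_hardy m"
  proof (rule bounded_hardy_cong)
    show "bounded_hardy (\<lambda>z. normalizer F * (snd p z / g z - F * (star (fst p) z / g z)))"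
      by (intro bounded_hardy_scale bounded_hardy_diff a b)
    show "normalizer F * (snd p z / g z - F * (star (fst p) z / g z)) = m z" if "cmod z = 1" for z
    proof -
      have "m z = (z * snd (ls_step p) z) / g z" by (simp add: m_def)
      then show ?thesis
        unfolding ls_step_circle(2)[OF that] using that
        by (simp add: star_circle F_def diff_divide_distrib right_diff_distrib)
    qed
  qed
  then have m': "ess_bounded haar m" "\<And>k. k < 0 \<Longrightarrow> fourier m k = 0" by (auto simp: bounded_hardy_def)
  have [measurable]: "m \<in> borel_measurable haar" using m'(1) by (rule ess_bounded_measurable)
  \<comment> \<open>The product \<open>m g\<close> is z times the stripped second component, so its
    constant coefficient is zero, while evaluation at 0 is multiplicative.\<close>
  have "fourier m 0 * fourier g 0 = fourier (\<lambda>z. m z * g z) 0"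
    by (simp add: fourier_bounded_hardy_mult[OF m g])
  also have "\<dots> = fourier (\<lambda>z. z powi 1 * snd (ls_step p) z) 0"
  proof (rule fourier_cong_AE)
    show "AE z in haar. m z * g z = z powi 1 * snd (ls_step p) z"
      using unit by eventually_elim (auto simp: m_def)
  qed simp_all
  also have "\<dots> = fourier (snd (ls_step p)) (0 - 1)" by (rule fourier_shift) simp
  also have "\<dots> = 0" by (rule q0) simp
  finally have m0: "fourier m 0 = 0" using g0 by simp
  show "bounded_hardy (\<lambda>z. snd (ls_step p) z / g z)"
  proof (rule bounded_hardy_cong)
    have "fourier (\<lambda>z. z powi (- 1) * m z) k = 0" if "k < 0" for k
    proof -
      have "fourier (\<lambda>z. z powi (- 1) * m z) k = fourier m (k - (- 1))" by (rule fourier_shift) simp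
      then show ?thesis using that m0 m'(2)[of "k + 1"] by (cases "k = -1") auto
    qed
    then show "bounded_hardy (\<lambda>z. z powi (- 1) * m z)"
      unfolding bounded_hardy_def by (intro conjI allI impI ess_bounded_mult ess_bounded_powi m'(1))
    show "z powi (- 1) * m z = snd (ls_step p) z / g z" if "cmod z = 1" for z
    proof -
      have "z \<noteq> 0" using that by auto
      then show ?thesis by (simp add: m_def power_int_minus)
    qed
  qed
qed

lemma star_quotient_ess_bounded:
  assumes p: "in_L p" and g: "inner_fun g"
  shows "ess_bounded haar (\<lambda>z. star (fst p) z / g z)" "ess_bounded haar (\<lambda>z. snd p z / g z)"
    "AE z in haar. cmod (star (fst p) z / g z) \<le> 1"
proof -
  note LD = in_L_D[OF p]
  have unit: "AE z in haar. cmod (g z) = 1" and [measurable]: "g \<in> borel_measurable haar"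
    using g by (auto simp: inner_fun_iff bounded_hardy_def ess_bounded_def)
  note [measurable] = ess_bounded_measurable[OF LD(2)]
  have [measurable]: "star (fst p) \<in> borel_measurable haar"
    using ess_bounded_measurable[OF LD(1)] by (simp add: star_measurable_iff)
  show *: "AE z in haar. cmod (star (fst p) z / g z) \<le> 1"
    using LD(4) unit AE_space by eventually_elim (simp add: norm_divide star_circle)
  then show "ess_bounded haar (\<lambda>z. star (fst p) z / g z)" by (rule ess_boundedI[rotated]) simp
  have "AE z in haar. cmod (snd p z / g z) \<le> 1"
    using LD(5) unit by eventually_elim (simp add: norm_divide)
  then show "ess_bounded haar (\<lambda>z. snd p z / g z)" by (rule ess_boundedI[rotated]) simp
qed

lemma in_H_NLFS:
  assumes "is_NLFS F p"
  shows "in_H p"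
  unfolding in_H_def
proof (intro conjI allI impI)
  show H: "in_Hbar p" by (rule is_NLFS_step(1)[OF assms])
  then have L: "in_L p" by (simp add: in_Hbar_iff)
  fix g assume "inner_fun g \<and> H2D (\<lambda>z. star (fst p) z / g z) \<and> H2D (\<lambda>z. snd p z / g z)"
  then have inner: "inner_fun g" and a: "bounded_hardy (\<lambda>z. star (fst p) z / g z)" and b: "bounded_hardy (\<lambda>z. snd p z / g z)"
    using star_quotient_ess_bounded[OF L] by (auto simp: H2D_ess_bounded)
  from inner have g: "bounded_hardy g" and unit: "AE z in haar. cmod (g z) = 1" by (auto simp: inner_fun_iff)
  have gb: "ess_bounded haar g" using g by (simp add: bounded_hardy_def)
  then have [measurable]: "g \<in> borel_measurable haar" by (rule ess_bounded_measurable)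
  \<comment> \<open>Evaluating the factorisation of \<open>star (fst q)\<close> through g at the
    origin. It shows that g does not vanish at 0 and later bounds g there from below.\<close>
  have prod: "cnj (fourier (fst q) 0) = fourier (\<lambda>z. star (fst q) z / g z) 0 * fourier g 0"
    if "in_L q" "bounded_hardy (\<lambda>z. star (fst q) z / g z)" for q
  proof -
    have [measurable]: "fst q \<in> borel_measurable haar" using that by (simp add: in_L_iff)
    then have [measurable]: "star (fst q) \<in> borel_measurable haar" by (simp add: star_measurable_iff)
    have "cnj (fourier (fst q) 0) = fourier (star (fst q)) 0" by (simp add: fourier_star)
    also have "\<dots> = fourier (\<lambda>z. star (fst q) z / g z * g z) 0"
      by (rule fourier_cong_AE) (use AE_quotient_mult[OF unit, of "star (fst q)"] in \<open>auto simp del: times_divide_eq_left\<close>)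
    finally show ?thesis by (simp only: fourier_bounded_hardy_mult[OF that(2) g])
  qed
  have "fourier (fst p) 0 \<noteq> 0" using in_L_D(8)[OF L] by auto
  then have g0: "fourier g 0 \<noteq> 0" using prod[OF L a] by auto
  have div: "bounded_hardy (\<lambda>z. star (fst (ls_pairs p n)) z / g z) \<and> bounded_hardy (\<lambda>z. snd (ls_pairs p n) z / g z)" for n
  proof (induction n)
    case (Suc n)
    then show ?case using ls_step_divisor[OF in_Hbar_ls_pairs[OF H] g unit g0] by simp
  qed (use a b in simp)
  have "Re (fourier (fst (ls_pairs p (Suc n))) 0) \<le> cmod (fourier g 0)" for n
  proof -
    let ?q = "ls_pairs p (Suc n)"
    have q: "in_L ?q" using in_Hbar_ls_pairs[OF H, of "Suc n"] by (simp add: in_Hbar_iff)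
    have "cmod (fourier (\<lambda>z. star (fst ?q) z / g z) 0) \<le> (\<integral>z. cmod (star (fst ?q) z / g z) \<partial>haar)"
      by (rule norm_fourier_le[OF star_quotient_ess_bounded(1)[OF q inner]])
    also have "\<dots> \<le> (\<integral>z. 1 \<partial>haar)"
      by (intro integral_mono_AE star_quotient_ess_bounded(3)[OF q inner] integrable_norm
            haar.ess_bounded_integrable star_quotient_ess_bounded(1)[OF q inner]) simp
    finally have *: "cmod (fourier (\<lambda>z. star (fst ?q) z / g z) 0) \<le> 1" using haar.prob_space by simp
    have "Re (fourier (fst ?q) 0) \<le> cmod (cnj (fourier (fst ?q) 0))" by (simp only: complex_mod_cnj complex_Re_le_cmod)
    also have "\<dots> = cmod (fourier (\<lambda>z. star (fst ?q) z / g z) 0) * cmod (fourier g 0)"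
      using div[of "Suc n"] by (simp only: prod[OF q] norm_mult)
    also have "\<dots> \<le> 1 * cmod (fourier g 0)" using * by (intro mult_right_mono) auto
    finally show ?thesis by simp
  qed
  \<comment> \<open>The values at infinity of the stripped pairs tend to 1, so their common upper
    bound is at least 1.\<close>
  then have ge1: "1 \<le> cmod (fourier g 0)"
    by (intro LIMSEQ_le_const2[OF fourier_ls_pairs_NLFS_tendsto_1[OF assms]]) auto
  \<comment> \<open>Unimodularity makes the squared distance from g to its mean 1 - |g(0)|^2, so the
    lower bound on |g(0)| forces g to be constant.\<close>
  have "(\<integral>z. (cmod (g z - fourier g 0))\<^sup>2 \<partial>haar) = (\<integral>z. 1 + (cmod (fourier g 0))\<^sup>2 - 2 * Re (g z * cnj (fourier g 0)) \<partial>haar)"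
  proof (rule integral_cong_AE)
    show "AE z in haar. (cmod (g z - fourier g 0))\<^sup>2 = 1 + (cmod (fourier g 0))\<^sup>2 - 2 * Re (g z * cnj (fourier g 0))"
      using unit by eventually_elim (simp only: cmod_diff_sq power_one)
  qed measurable
  also have "\<dots> = 1 + (cmod (fourier g 0))\<^sup>2 - 2 * Re (\<integral>z. g z * cnj (fourier g 0) \<partial>haar)"
  proof -
    have int: "integrable haar (\<lambda>z. g z * cnj (fourier g 0))"
      by (intro haar.ess_bounded_integrable ess_bounded_intros gb)
    have "(\<integral>z. 2 * Re (g z * cnj (fourier g 0)) \<partial>haar) = 2 * Re (\<integral>z. g z * cnj (fourier g 0) \<partial>haar)"
      by (simp only: integral_mult_right_zero integral_Re[OF int])
    moreover have "integrable haar (\<lambda>z. 2 * Re (g z * cnj (fourier g 0)))"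
      by (intro integrable_mult_right integrable_Re int)
    moreover have "(\<integral>z. 1 + (cmod (fourier g 0))\<^sup>2 \<partial>haar) = 1 + (cmod (fourier g 0))\<^sup>2"
      using haar.prob_space by simp
    ultimately show ?thesis
      by (subst Bochner_Integration.integral_diff) (simp_all only: haar.integrable_const)
  qed
  also have "(\<integral>z. g z * cnj (fourier g 0) \<partial>haar) = fourier g 0 * cnj (fourier g 0)"
    by (simp add: fourier_haar)
  also have "Re (fourier g 0 * cnj (fourier g 0)) = (cmod (fourier g 0))\<^sup>2"
    by (simp only: complex_norm_square[symmetric] Re_complex_of_real)
  finally have "(\<integral>z. (cmod (g z - fourier g 0))\<^sup>2 \<partial>haar) = 1 - (cmod (fourier g 0))\<^sup>2" by simp
  also have "\<dots> \<le> 0" using ge1 by (simp add: one_le_power)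
  finally have "(\<integral>z. (cmod (g z - fourier g 0))\<^sup>2 \<partial>haar) = 0"
    by (intro antisym integral_nonneg_AE) auto
  then have "AE z in haar. (cmod (g z - fourier g 0))\<^sup>2 = 0"
    by (subst (asm) integral_nonneg_eq_0_iff_AE)
       (auto intro!: haar.ess_bounded_integrable2 ess_bounded_intros gb)
  then show "const_on_T g" by (auto simp: const_on_T_iff)
qed

section \<open>Reconstruction from the layer stripping sequence\<close>

text \<open>The factorisation of p into a partial product on the left and the stripped pair on the
  right. Moving z past n + 1 layers gives the tail its factor \<open>z ^ Suc n\<close>.\<close>

lemma nlfs_partial_tail:
  assumes H: "in_Hbar p" and F: "\<And>j. F (int j) = ls_seq p j" and z: "cmod z = 1"
  shows "fst p z = fst (nlfs_partial F n) z * fst (ls_pairs p (Suc n)) z -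
      snd (nlfs_partial F n) z * cnj (z ^ Suc n * snd (ls_pairs p (Suc n)) z)"
    "snd p z = fst (nlfs_partial F n) z * (z ^ Suc n * snd (ls_pairs p (Suc n)) z) +
      snd (nlfs_partial F n) z * cnj (fst (ls_pairs p (Suc n)) z)"
proof -
  have "fst p z = fst (nlfs_partial F n) z * fst (ls_pairs p (Suc n)) z -
      snd (nlfs_partial F n) z * cnj (z ^ Suc n * snd (ls_pairs p (Suc n)) z) \<and>
    snd p z = fst (nlfs_partial F n) z * (z ^ Suc n * snd (ls_pairs p (Suc n)) z) +
      snd (nlfs_partial F n) z * cnj (fst (ls_pairs p (Suc n)) z)"
  proof (induction n)
    case 0
    have "F 0 = ls_coeff p" using F[of 0] by (simp add: ls_seq_def)
    then show ?case
      using in_Hbar_ls_step(2)[OF H] z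
      by (simp add: nlfs_partial_circle[OF z] pair_eq_def layer_def algebra_simps del: nlfs_partial.simps)
  next
    case (Suc n)
    define a where "a = fst (nlfs_partial F n) z"
    define b where "b = snd (nlfs_partial F n) z"
    define u where "u = z ^ Suc n"
    define G where "G = F (int (Suc n))"
    define c where "c = complex_of_real (normalizer G)"
    define x where "x = fst (ls_pairs p (Suc (Suc n))) z"
    define y where "y = snd (ls_pairs p (Suc (Suc n))) z"
    have "ls_coeff (ls_pairs p (Suc n)) = G" by (simp add: G_def F ls_seq_def del: ls_pairs.simps of_nat_Suc)
    then have "ls_pairs p (Suc n) =\<^sub>T layer G (ls_pairs p (Suc (Suc n)))"
      using in_Hbar_ls_step(2)[OF in_Hbar_ls_pairs[OF H, of "Suc n"]] by simp
    then have xy: "fst (ls_pairs p (Suc n)) z = c * (x - G * cnj (z * y))"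
      "snd (ls_pairs p (Suc n)) z = c * (z * y + G * cnj x)"
      using z by (simp_all only: pair_eq_def layer_def fst_conv snd_conv c_def x_def y_def)
    have ab: "fst (nlfs_partial F (Suc n)) z = c * (a - b * cnj (G * u))"
      "snd (nlfs_partial F (Suc n)) z = c * (a * (G * u) + b)"
      unfolding nlfs_partial_circle(3,4)[OF z] by (simp_all only: a_def b_def c_def G_def u_def)
    have u: "z ^ Suc (Suc n) = z * u" by (simp add: u_def)
    have "cmod u = 1" using z by (simp add: u_def norm_mult norm_power)
    then have uu: "u * cnj u = 1" by (rule unimodular_mult_cnj)
    have cc: "cnj c = c" by (simp add: c_def)
    show ?case
      unfolding u ab x_def[symmetric] y_def[symmetric]
      using Suc[folded a_def b_def u_def] uu cc unfolding xy
      by (simp only: complex_cnj_mult complex_cnj_add complex_cnj_diff complex_cnj_cnj) (intro conjI; algebra)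
  qed
  then show "fst p z = fst (nlfs_partial F n) z * fst (ls_pairs p (Suc n)) z -
      snd (nlfs_partial F n) z * cnj (z ^ Suc n * snd (ls_pairs p (Suc n)) z)"
    "snd p z = fst (nlfs_partial F n) z * (z ^ Suc n * snd (ls_pairs p (Suc n)) z) +
      snd (nlfs_partial F n) z * cnj (fst (ls_pairs p (Suc n)) z)" by blast+
qed

text \<open>Left multiplication by a unit pair \<open>(a, b)\<close> is undone by left
  multiplication by \<open>(cnj a, - b)\<close>.\<close>

lemma rotation_inverse:
  fixes a b x y s t :: complex
  assumes "s = a * x - b * cnj y" "t = a * y + b * cnj x" "(cmod a)\<^sup>2 + (cmod b)\<^sup>2 = 1"
  shows "x = cnj a * s + b * cnj t" "y = cnj a * t - b * cnj s"
proof -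
  have *: "a * cnj a + b * cnj b = 1" using assms(3) by (simp only: norm_sq_sum_eq_1_iff)
  have "x = (a * cnj a + b * cnj b) * x" "y = (a * cnj a + b * cnj b) * y" by (simp_all only: * mult_1_left)
  then show "x = cnj a * s + b * cnj t" "y = cnj a * t - b * cnj s"
    unfolding assms(1,2) by (simp_all add: algebra_simps)
qed

text \<open>The increments have L^1 norms at most 2^(-i), so the sum of their moduli has a finite
  integral. At almost every point the telescoping series therefore converges absolutely.\<close>

lemma (in prob_space) AE_convergent_of_L2_fast:
  fixes f :: "nat \<Rightarrow> 'a \<Rightarrow> complex"
  assumes f: "\<And>i. ess_bounded M (f i)"
    and fast: "\<And>i. (\<integral>x. (cmod (f (Suc i) x - f i x))\<^sup>2 \<partial>M) \<le> (1 / 4) ^ i"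
  shows "AE x in M. convergent (\<lambda>i. f i x)"
proof -
  let ?d = "\<lambda>i x. f (Suc i) x - f i x"
  have d: "ess_bounded M (?d i)" for i by (intro ess_bounded_diff f)
  note [measurable] = ess_bounded_measurable[OF f]
  have "(\<integral>\<^sup>+x. (\<Sum>i. ennreal (cmod (?d i x))) \<partial>M) = (\<Sum>i. \<integral>\<^sup>+x. ennreal (cmod (?d i x)) \<partial>M)"
    by (rule nn_integral_suminf) measurable
  also have "\<dots> \<le> (\<Sum>i. ennreal ((1 / 2) ^ i))"
  proof (rule suminf_le)
    fix i
    have "(\<integral>\<^sup>+x. ennreal (cmod (?d i x)) \<partial>M) = ennreal (\<integral>x. cmod (?d i x) \<partial>M)"
      by (intro nn_integral_eq_integral integrable_norm ess_bounded_integrable d) simp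
    also have "(\<integral>x. cmod (?d i x) \<partial>M) \<le> sqrt (\<integral>x. (cmod (?d i x))\<^sup>2 \<partial>M)"
      by (rule integral_norm_le_L2[OF d])
    also have "\<dots> \<le> sqrt (((1 / 2) ^ i)\<^sup>2)"
    proof -
      have "((1 / 2) ^ i)\<^sup>2 = (1 / 4 :: real) ^ i"
        by (simp add: power2_eq_square flip: power_mult_distrib)
      then show ?thesis using fast[of i] by simp
    qed
    also have "\<dots> = (1 / 2) ^ i" by simp
    finally show "(\<integral>\<^sup>+x. ennreal (cmod (?d i x)) \<partial>M) \<le> ennreal ((1 / 2) ^ i)"
      by (simp add: ennreal_leI)
  qed simp_all
  also have "\<dots> = ennreal (\<Sum>i. (1 / 2) ^ i)"
    by (rule suminf_ennreal2) (auto intro: summable_geometric)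
  finally have "(\<integral>\<^sup>+x. (\<Sum>i. ennreal (cmod (?d i x))) \<partial>M) \<noteq> \<infinity>"
    by (auto simp: top_unique)
  then have "AE x in M. (\<Sum>i. ennreal (cmod (?d i x))) \<noteq> \<infinity>"
    by (intro nn_integral_PInf_AE) measurable
  then show ?thesis
  proof eventually_elim
    case (elim x)
    then have "summable (\<lambda>i. cmod (?d i x))"
      by (intro summable_suminf_not_top) auto
    then have "summable (\<lambda>i. ?d i x)" by (rule summable_norm_cancel)
    then have "convergent (\<lambda>n. \<Sum>i<n. ?d i x)" by (simp add: summable_iff_convergent)
    moreover have "(\<Sum>i<n. ?d i x) = f n x - f 0 x" for n by (rule sum_lessThan_telescope)
    ultimately have "convergent (\<lambda>n. f n x - f 0 x + f 0 x)"
      by (intro convergent_add convergent_const) simp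
    then show ?case by simp
  qed
qed

lemma sum_le_prod_1_plus: "finite A \<Longrightarrow> (\<And>x. x \<in> A \<Longrightarrow> f x \<ge> 0) \<Longrightarrow> 1 + (\<Sum>x\<in>A. f x) \<le> (\<Prod>x\<in>A. 1 + f x :: real)"
proof (induction A rule: finite_induct)
  case (insert x A)
  then have IH: "1 + sum f A \<le> (\<Prod>x\<in>A. 1 + f x)" and "f x \<ge> 0" "sum f A \<ge> 0"
    by (auto intro: sum_nonneg)
  have "1 + sum f (insert x A) \<le> (1 + f x) * (1 + sum f A)"
    using insert \<open>f x \<ge> 0\<close> \<open>sum f A \<ge> 0\<close> by (simp add: algebra_simps)
  also have "\<dots> \<le> (1 + f x) * (\<Prod>x\<in>A. 1 + f x)"
    using IH \<open>f x \<ge> 0\<close> by (intro mult_left_mono) auto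
  finally show ?case using insert by simp
qed simp

section \<open>Values at infinity along the stripping of a fixed pair\<close>

context
  fixes p assumes H: "in_Hbar p"
begin

private definition Q where "Q n = (\<Prod>j<n. normalizer (ls_seq p j))"
private definition A where "A n = Re (fourier (fst (ls_pairs p n)) 0)"

private lemma in_L_ls_pairs: "in_L (ls_pairs p n)"
  using in_Hbar_ls_pairs[OF H, of n] by (simp add: in_Hbar_iff)

private lemma A_bounds: "0 < A n" "A n \<le> 1"
proof -
  note LD = in_L_D[OF in_L_ls_pairs[of n]]
  show "0 < A n" using LD(8) by (simp add: A_def)
  have "A n \<le> cmod (fourier (fst (ls_pairs p n)) 0)" by (simp add: A_def complex_Re_le_cmod)
  also have "\<dots> \<le> (\<integral>z. cmod (fst (ls_pairs p n) z) \<partial>haar)" by (rule norm_fourier_le[OF LD(1)])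
  also have "\<dots> \<le> (\<integral>z. 1 \<partial>haar)"
    by (intro integral_mono_AE LD(4) integrable_norm haar.ess_bounded_integrable LD(1)) simp
  finally show "A n \<le> 1" using haar.prob_space by simp
qed

private lemma Q_pos: "0 < Q n"
  unfolding Q_def by (intro prod_pos normalizer_pos)

private lemma A_Q: "A 0 = Q n * A n"
  using arg_cong[OF fourier_ls_pairs[OF H, of n], of Re] by (simp add: A_def Q_def del: of_real_prod)

private lemma Q_ge: "A 0 \<le> Q n"
  using A_Q[of n] A_bounds[of n] Q_pos[of n] by (simp add: mult_left_le)

private lemma Q_decseq: "decseq Q"
proof (rule decseq_SucI)
  show "Q (Suc n) \<le> Q n" for n
    using Q_pos[of n] normalizer_le_1 by (simp add: Q_def mult_left_le)
qed

text \<open>The product of the factors 1 + |F_j|^2 is the inverse square of \<open>Q\<close>, which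
  stays above the positive number \<open>A 0\<close>; such a product dominates the sum of the
  |F_j|^2.\<close>

lemma summable_ls_seq: "summable (\<lambda>n. (cmod (ls_seq p n))\<^sup>2)"
proof (rule summableI_nonneg_bounded)
  fix n
  have "(Q n)\<^sup>2 * (\<Prod>j<n. 1 + (cmod (ls_seq p j))\<^sup>2) = 1"
    by (simp add: Q_def prod_power_distrib prod.distrib[symmetric] normalizer_sq)
  moreover have "(A 0)\<^sup>2 \<le> (Q n)\<^sup>2"
    using Q_ge A_bounds(1)[of 0] by (intro power_mono) auto
  moreover have P: "(\<Prod>j<n. 1 + (cmod (ls_seq p j))\<^sup>2) \<ge> 0" by (intro prod_nonneg) auto
  ultimately have "(A 0)\<^sup>2 * (\<Prod>j<n. 1 + (cmod (ls_seq p j))\<^sup>2) \<le> 1"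
    by (metis mult_right_mono)
  then have "(\<Prod>j<n. 1 + (cmod (ls_seq p j))\<^sup>2) \<le> 1 / (A 0)\<^sup>2"
    using A_bounds(1)[of 0] by (simp add: pos_le_divide_eq mult.commute)
  then show "(\<Sum>j<n. (cmod (ls_seq p j))\<^sup>2) \<le> 1 / (A 0)\<^sup>2"
    using sum_le_prod_1_plus[of "{..<n}" "\<lambda>j. (cmod (ls_seq p j))\<^sup>2"] by simp
qed simp

text \<open>\<open>Q\<close> decreases and stays above \<open>A 0 > 0\<close>, so it has a positive
  limit, and \<open>A\<close> is the quotient of \<open>A 0\<close> by \<open>Q\<close>.\<close>

private lemma A_convergent: obtains l where "l > 0" "A \<longlonglongrightarrow> l"
proof -
  obtain q where q: "Q \<longlonglongrightarrow> q"
    using decseq_convergent[OF Q_decseq, of 0] Q_pos by (meson less_imp_le)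
  have "A 0 \<le> q" using Q_ge by (intro LIMSEQ_le_const[OF q]) auto
  then have "q > 0" using A_bounds(1)[of 0] by linarith
  have "(\<lambda>n. A 0 / Q n) = A"
  proof
    show "A 0 / Q n = A n" for n using A_Q[of n] Q_pos[of n] by simp
  qed
  moreover have "(\<lambda>n. A 0 / Q n) \<longlonglongrightarrow> A 0 / q" using \<open>q > 0\<close> by (intro tendsto_intros q) simp
  ultimately have "A \<longlonglongrightarrow> A 0 / q" by (simp only:)
  then show thesis using that[of "A 0 / q"] \<open>q > 0\<close> A_bounds(1)[of 0] by simp
qed

context
  fixes F assumes F: "\<And>j. F (int j) = ls_seq p j"
begin

private lemma pair_dist_partials:
  assumes "k < m"
  shows "pair_dist (nlfs_partial F m) (nlfs_partial F k) = 2 - 2 * (Q (Suc m) / Q (Suc k))"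
proof -
  obtain n where m: "m = k + Suc n" using assms less_iff_Suc_add by auto
  have "Q (Suc m) = Q (Suc k) * (\<Prod>j\<le>n. normalizer (F (int (Suc k + j))))"
    unfolding m
  proof (induction n)
    case (Suc n)
    have "Q (Suc (k + Suc (Suc n))) = Q (Suc (k + Suc n)) * normalizer (ls_seq p (k + Suc (Suc n)))"
      by (simp add: Q_def)
    then show ?case using Suc by (simp add: F del: of_nat_Suc of_nat_add)
  qed (simp add: Q_def F del: of_nat_Suc of_nat_add)
  then have "(\<Prod>j\<le>n. normalizer (F (int (Suc k + j)))) = Q (Suc m) / Q (Suc k)"
    using Q_pos[of "Suc k"] by (simp add: field_simps)
  then show ?thesis unfolding m pair_dist_nlfs_partial by simp
qed

text \<open>The distance is governed by the ratio of two values of \<open>A\<close>. As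
  \<open>A\<close> increases to a positive limit, this ratio tends to 1 uniformly in the larger
  index, so the partial products form a Cauchy sequence.\<close>

private lemma fast_subsequence:
  obtains r where "strict_mono r"
    "\<And>i. pair_dist (nlfs_partial F (r (Suc i))) (nlfs_partial F (r i)) \<le> (1 / 4) ^ i"
proof -
  obtain l where l: "l > 0" "A \<longlonglongrightarrow> l" by (rule A_convergent)
  have dist: "pair_dist (nlfs_partial F m) (nlfs_partial F k) = 2 - 2 * (A (Suc k) / A (Suc m))" if "k < m" for k m
  proof -
    have "Q (Suc m) / Q (Suc k) = A (Suc k) / A (Suc m)"
      using A_Q[of "Suc m"] A_Q[of "Suc k"] Q_pos[of "Suc k"] A_bounds(1)[of "Suc m"]
      by (simp add: field_simps)
    then show ?thesis using pair_dist_partials[OF that] by simp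
  qed
  have "\<exists>N. \<forall>k\<ge>N. \<forall>m>k. pair_dist (nlfs_partial F m) (nlfs_partial F k) \<le> (1 / 4) ^ i" for i :: nat
  proof -
    define e :: real where "e = (1 / 4) ^ i"
    have "e > 0" by (simp add: e_def)
    have "l * (1 - e / 2) < l" using l \<open>e > 0\<close> by (simp add: algebra_simps)
    have Al: "A n \<le> l" for n
    proof -
      have "incseq A"
      proof (rule incseq_SucI)
        fix n
        have "Q (Suc n) * A n \<le> Q n * A n" using Q_decseq A_bounds(1)[of n] by (intro mult_right_mono) (auto simp: decseq_Suc_iff)
        also have "\<dots> = Q (Suc n) * A (Suc n)" using A_Q[of n] A_Q[of "Suc n"] by simp
        finally show "A n \<le> A (Suc n)" using Q_pos[of "Suc n"] by simp
      qed
      then show ?thesis using l(2) by (rule incseq_le)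
    qed
    obtain N where N: "\<And>n. n \<ge> N \<Longrightarrow> A n > l * (1 - e / 2)"
      using order_tendstoD(1)[OF l(2) \<open>l * (1 - e / 2) < l\<close>] by (auto simp: eventually_sequentially)
    have "2 - 2 * (A (Suc k) / A (Suc m)) \<le> e" if "k \<ge> N" for k m
    proof -
      have "(1 - e / 2) * l \<le> A (Suc k)" using N[of "Suc k"] that by (simp add: mult.commute)
      then have "1 - e / 2 \<le> A (Suc k) / l" using l by (simp add: field_simps)
      also have "\<dots> \<le> A (Suc k) / A (Suc m)"
        using Al[of "Suc m"] A_bounds(1)[of "Suc m"] A_bounds(1)[of "Suc k"] by (intro divide_left_mono) auto
      finally show ?thesis by simp
    qed
    then show ?thesis by (intro exI[of _ N]) (auto simp: dist e_def)
  qed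
  then obtain K where K: "\<And>i k m. k \<ge> K i \<Longrightarrow> k < m \<Longrightarrow> pair_dist (nlfs_partial F m) (nlfs_partial F k) \<le> (1 / 4) ^ i"
    by metis
  \<comment> \<open>The sum dominates every \<open>K i\<close>, and the summand i makes r strictly
    increasing.\<close>
  define r where "r i = i + (\<Sum>j\<le>i. K j)" for i
  have "K i \<le> r i" for i
    using member_le_sum[of i "{..i}" K] by (simp add: r_def)
  moreover have less: "r i < r (Suc i)" for i by (simp add: r_def)
  ultimately show thesis
    using K by (intro that[of r]) (auto simp: strict_mono_Suc_iff)
qed

lemma is_NLFS_ls_seq:
  assumes inH: "in_H p"
  shows "is_NLFS F p"
proof -
  obtain r where r: "strict_mono r"
      "\<And>i. pair_dist (nlfs_partial F (r (Suc i))) (nlfs_partial F (r i)) \<le> (1 / 4) ^ i"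
    by (rule fast_subsequence) blast
  obtain l where l: "l > 0" "A \<longlonglongrightarrow> l" by (rule A_convergent)
  define a where "a i = fst (nlfs_partial F (r i))" for i
  define b where "b i = snd (nlfs_partial F (r i))" for i
  define x where "x i = fst (ls_pairs p (Suc (r i)))" for i
  \<comment> \<open>The power of z moves all frequencies of the tail to at least
    \<open>Suc (r i)\<close>; this is what makes them disappear in the limit.\<close>
  define y where "y i z = z powi int (Suc (r i)) * snd (ls_pairs p (Suc (r i))) z" for i z
  note Lp = in_L_ls_pairs[of 0, simplified]
  note LDp = in_L_D[OF Lp]
  note LDn = in_L_D[OF nlfs_partial_in_L[of F "r i" for i], folded a_def b_def]
  note LDx = in_L_D[OF in_L_ls_pairs[of "Suc (r i)" for i]]
  note [measurable] = ess_bounded_measurable[OF LDp(1)] ess_bounded_measurable[OF LDp(2)]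
    ess_bounded_measurable[OF LDn(1)] ess_bounded_measurable[OF LDn(2)]
    ess_bounded_measurable[OF LDx(1)] ess_bounded_measurable[OF LDx(2)]
  have fast: "(\<integral>z. (cmod (a (Suc i) z - a i z))\<^sup>2 \<partial>haar) \<le> (1 / 4) ^ i"
    "(\<integral>z. (cmod (b (Suc i) z - b i z))\<^sup>2 \<partial>haar) \<le> (1 / 4) ^ i" for i
  proof -
    have "(\<integral>z. (cmod (a (Suc i) z - a i z))\<^sup>2 \<partial>haar) + (\<integral>z. (cmod (b (Suc i) z - b i z))\<^sup>2 \<partial>haar) \<le> (1 / 4) ^ i"
      using r(2)[of i] unfolding pair_dist_split[OF nlfs_partial_in_L nlfs_partial_in_L] a_def b_def .
    moreover have "(\<integral>z. (cmod (a (Suc i) z - a i z))\<^sup>2 \<partial>haar) \<ge> 0" "(\<integral>z. (cmod (b (Suc i) z - b i z))\<^sup>2 \<partial>haar) \<ge> 0"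
      by (simp_all add: integral_nonneg_AE)
    ultimately show "(\<integral>z. (cmod (a (Suc i) z - a i z))\<^sup>2 \<partial>haar) \<le> (1 / 4) ^ i"
      "(\<integral>z. (cmod (b (Suc i) z - b i z))\<^sup>2 \<partial>haar) \<le> (1 / 4) ^ i" by linarith+
  qed
  \<comment> \<open>Where the sequence diverges, \<open>lim\<close> has an unspecified value; this
    happens only on a null set.\<close>
  define a' where "a' z = lim (\<lambda>i. a i z)" for z
  define b' where "b' z = lim (\<lambda>i. b i z)" for z
  have [measurable]: "a' \<in> borel_measurable haar" "b' \<in> borel_measurable haar"
    unfolding a'_def b'_def by measurable
  have a_lim: "AE z in haar. (\<lambda>i. a i z) \<longlonglongrightarrow> a' z"
    using haar.AE_convergent_of_L2_fast[OF LDn(1) fast(1)]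
    by eventually_elim (simp add: a'_def convergent_LIMSEQ_iff)
  have b_lim: "AE z in haar. (\<lambda>i. b i z) \<longlonglongrightarrow> b' z"
    using haar.AE_convergent_of_L2_fast[OF LDn(2) fast(2)]
    by eventually_elim (simp add: b'_def convergent_LIMSEQ_iff)
  \<comment> \<open>The inverse of the limit \<open>(a', b')\<close> applied to p: the only possible
    limit of the tails, which are recovered in the same way from the partial products.\<close>
  define X where "X z = cnj (a' z) * fst p z + b' z * cnj (snd p z)" for z
  define Y where "Y z = cnj (a' z) * snd p z - b' z * cnj (fst p z)" for z
  have [measurable]: "X \<in> borel_measurable haar" "Y \<in> borel_measurable haar"
    unfolding X_def Y_def by measurable
  have ab_unit: "AE z in haar. \<forall>i. (cmod (a i z))\<^sup>2 + (cmod (b i z))\<^sup>2 = 1"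
    using LDn(3) by (simp add: AE_all_countable)
  have tail: "fst p z = a i z * x i z - b i z * cnj (y i z)" "snd p z = a i z * y i z + b i z * cnj (x i z)"
    if "cmod z = 1" for i z
    using nlfs_partial_tail[OF H F that, of "r i"] by (simp_all only: a_def b_def x_def y_def power_int_of_nat)
  have xy_unit: "AE z in haar. (cmod (x i z))\<^sup>2 + (cmod (y i z))\<^sup>2 = 1" for i
    using LDx(3)[of i] AE_space
    by eventually_elim (simp add: x_def y_def norm_mult norm_power del: ls_pairs.simps of_nat_Suc)
  have xy_meas [measurable]: "x i \<in> borel_measurable haar" "y i \<in> borel_measurable haar" for i
    unfolding x_def y_def by measurable
  note xy_bd = ess_bounded_unit[OF xy_meas xy_unit]
  have xy_lim: "AE z in haar. (\<lambda>i. x i z) \<longlonglongrightarrow> X z \<and> (\<lambda>i. y i z) \<longlonglongrightarrow> Y z"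
    using a_lim b_lim ab_unit AE_space
  proof eventually_elim
    case (elim z)
    then have z: "cmod z = 1" by simp
    have xy: "x i z = cnj (a i z) * fst p z + b i z * cnj (snd p z)"
      "y i z = cnj (a i z) * snd p z - b i z * cnj (fst p z)" for i
      using rotation_inverse[OF tail[OF z] elim(3)[rule_format]] by blast+
    show ?case unfolding xy X_def Y_def by (intro conjI tendsto_intros elim)
  qed
  from xy_lim have x_lim: "AE z in haar. (\<lambda>i. x i z) \<longlonglongrightarrow> X z" by eventually_elim simp
  from xy_lim have y_lim: "AE z in haar. (\<lambda>i. y i z) \<longlonglongrightarrow> Y z" by eventually_elim simp
  have "AE z in haar. \<forall>i. (cmod (x i z))\<^sup>2 + (cmod (y i z))\<^sup>2 = 1"
    using xy_unit by (simp add: AE_all_countable)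
  then have XY_unit: "AE z in haar. (cmod (X z))\<^sup>2 + (cmod (Y z))\<^sup>2 = 1"
    using xy_lim
  proof eventually_elim
    case (elim z)
    then have "(\<lambda>i. (cmod (x i z))\<^sup>2 + (cmod (y i z))\<^sup>2) \<longlonglongrightarrow> (cmod (X z))\<^sup>2 + (cmod (Y z))\<^sup>2"
      by (intro tendsto_intros) auto
    then show ?case using elim(1) by (simp add: LIMSEQ_const_iff)
  qed
  note XY_bd = ess_bounded_unit[OF \<open>X \<in> borel_measurable haar\<close> \<open>Y \<in> borel_measurable haar\<close> XY_unit]
  \<comment> \<open>For fixed k the frequencies of \<open>y i\<close> eventually all lie beyond k,
    so the coefficient is zero from some index on.\<close>
  have "fourier Y k = 0" for k
  proof -
    have "(\<lambda>i. fourier (y i) k) \<longlonglongrightarrow> fourier Y k"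
      by (rule fourier_limit[OF _ _ xy_bd(2) y_lim]) measurable
    moreover have "eventually (\<lambda>i. fourier (y i) k = 0) sequentially"
      using eventually_ge_at_top[of "nat \<bar>k\<bar>"]
    proof eventually_elim
      case (elim i)
      have "fourier (y i) k = fourier (snd (ls_pairs p (Suc (r i)))) (k - int (Suc (r i)))"
        unfolding y_def by (rule fourier_shift) measurable
      moreover have "k - int (Suc (r i)) < 0"
        using elim seq_suble[OF r(1), of i] by linarith
      ultimately show ?case using in_Hbar_ls_pairs[OF H, of "Suc (r i)"] by (simp add: in_Hbar_iff)
    qed
    ultimately show ?thesis by (rule LIMSEQ_unique[OF _ tendsto_eventually])
  qed
  then have Y0: "AE z in haar. Y z = 0" by (rule fourier_eq_0_imp_AE_eq_0[OF XY_bd(4)])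
  then have X1: "AE z in haar. cmod (X z) = 1"
    using XY_unit by eventually_elim (simp add: power2_eq_1_iff[of "cmod _"] abs_square_eq_1)
  have X_lim: "(\<lambda>i. fourier (x i) k) \<longlonglongrightarrow> fourier X k" for k
    by (rule fourier_limit[OF _ _ xy_bd(1) x_lim]) measurable
  have X_neg: "fourier X k = 0" if "k > 0" for k
  proof -
    have "fourier (x i) k = 0" for i using LDx(6)[OF that, of i] by (simp add: x_def)
    then show ?thesis using X_lim[of k] by (simp add: LIMSEQ_const_iff)
  qed
  have X0: "fourier X 0 = of_real l"
  proof -
    have "(\<lambda>i. complex_of_real (A (Suc (r i)))) \<longlonglongrightarrow> of_real l"
      using LIMSEQ_subseq_LIMSEQ[OF LIMSEQ_Suc[OF l(2)] r(1)] by (intro tendsto_of_real) (simp add: o_def)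
    moreover have "fourier (x i) 0 = of_real (A (Suc (r i)))" for i
      unfolding A_def x_def by (rule LDx(7))
    ultimately have "(\<lambda>i. fourier (x i) 0) \<longlonglongrightarrow> of_real l" by (simp only:)
    then show ?thesis by (rule LIMSEQ_unique[OF X_lim])
  qed
  \<comment> \<open>On the circle this is \<open>star X\<close>. Vanishing positive coefficients of
    X place it in H^infinity, and \<open>Y = 0\<close> makes it unimodular, so it is inner.\<close>
  define g where "g z = cnj (X z)" for z
  have [measurable]: "g \<in> borel_measurable haar" unfolding g_def by measurable
  have g_unit: "AE z in haar. cmod (g z) = 1" using X1 by eventually_elim (simp add: g_def)
  have g_fourier: "fourier g k = cnj (fourier X (- k))" for k
    unfolding g_def by (rule fourier_cnj) measurable
  have "ess_bounded haar g" unfolding g_def by (rule ess_bounded_cnj[OF XY_bd(3)])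
  then have "bounded_hardy g" using X_neg by (simp add: bounded_hardy_def g_fourier)
  with g_unit have inner: "inner_fun g" by (simp add: inner_fun_iff)
  note q_bd = star_quotient_ess_bounded[OF Lp inner]
  note [measurable] = ess_bounded_measurable[OF q_bd(1)] ess_bounded_measurable[OF q_bd(2)]
  \<comment> \<open>With \<open>Y = 0\<close> the limiting factorisation is diagonal on the right.
    Dividing by g leaves \<open>cnj a'\<close> and \<open>b'\<close>, which inherit vanishing
    negative coefficients from the partial products.\<close>
  have p_lim: "AE z in haar. fst p z = a' z * X z \<and> snd p z = b' z * cnj (X z)"
    using a_lim b_lim xy_lim Y0 AE_space
  proof eventually_elim
    case (elim z)
    then have z: "cmod z = 1" by simp
    note lims = elim(1,2) elim(3)[THEN conjunct1] elim(3)[THEN conjunct2]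
    have "(\<lambda>i. a i z * x i z - b i z * cnj (y i z)) \<longlonglongrightarrow> a' z * X z - b' z * cnj (Y z)"
      "(\<lambda>i. a i z * y i z + b i z * cnj (x i z)) \<longlonglongrightarrow> a' z * Y z + b' z * cnj (X z)"
      by (intro tendsto_intros lims)+
    then show ?case using elim(4) by (simp add: tail[OF z, symmetric] LIMSEQ_const_iff)
  qed
  have "H2D (\<lambda>z. star (fst p) z / g z)"
  proof -
    have "fourier (\<lambda>z. star (fst p) z / g z) k = 0" if "k < 0" for k
    proof -
      have "AE z in haar. star (fst p) z / g z = cnj (a' z)"
        using p_lim g_unit AE_space by eventually_elim (auto simp: star_circle g_def)
      then have "fourier (\<lambda>z. star (fst p) z / g z) k = fourier (\<lambda>z. cnj (a' z)) k"
        by (intro fourier_cong_AE) measurable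
      also have "\<dots> = cnj (fourier a' (- k))" by (rule fourier_cnj) measurable
      also have "fourier a' (- k) = 0"
      proof -
        have "(\<lambda>i. fourier (a i) (- k)) \<longlonglongrightarrow> fourier a' (- k)"
          by (rule fourier_limit[OF _ _ LDn(4) a_lim]) measurable
        then show ?thesis using LDn(6)[of "- k"] that by (simp add: LIMSEQ_const_iff)
      qed
      finally show ?thesis by simp
    qed
    then show ?thesis using q_bd(1) by (simp add: H2D_ess_bounded bounded_hardy_def)
  qed
  moreover have "H2D (\<lambda>z. snd p z / g z)"
  proof -
    have "fourier (\<lambda>z. snd p z / g z) k = 0" if "k < 0" for k
    proof -
      have "AE z in haar. snd p z / g z = b' z"
        using p_lim g_unit by eventually_elim (auto simp: g_def)
      then have "fourier (\<lambda>z. snd p z / g z) k = fourier b' k"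
        by (intro fourier_cong_AE) measurable
      also have "fourier b' k = 0"
      proof -
        have "(\<lambda>i. fourier (b i) k) \<longlonglongrightarrow> fourier b' k"
          by (rule fourier_limit[OF _ _ LDn(5) b_lim]) measurable
        moreover have "fourier (b i) k = 0" for i
          using nlfs_partial_in_Hbar[of F "r i"] that by (simp add: in_Hbar_iff b_def)
        ultimately show ?thesis by (simp add: LIMSEQ_const_iff)
      qed
      finally show ?thesis .
    qed
    then show ?thesis using q_bd(2) by (simp add: H2D_ess_bounded bounded_hardy_def)
  qed
  ultimately have "const_on_T g" using inH inner unfolding in_H_def by blast
  then obtain c where c: "AE z in haar. g z = c" by (auto simp: const_on_T_iff)
  then have "fourier g 0 = fourier (\<lambda>_. c) 0" by (intro fourier_cong_AE) measurable
  \<comment> \<open>The constant g equals its coefficient at 0, which is the positive number l;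
    being unimodular as well, it must be 1.\<close>
  then have "c = of_real l" by (simp add: fourier_const g_fourier X0)
  moreover have "cmod c = 1"
  proof -
    have "AE z in haar. cmod c = 1" using c g_unit by eventually_elim simp
    then show ?thesis by simp
  qed
  ultimately have "l = 1" using l(1) by simp
  \<comment> \<open>The distance formula covers all k, so \<open>l = 1\<close> gives convergence of
    the whole sequence, not just of the subsequence.\<close>
  have "pair_dist (nlfs_partial F k) p = 2 - 2 * A (Suc k)" for k
    using pair_dist_nlfs_ls_seq[OF H F, of k] by (simp only: pair_dist_commute[of p] A_def)
  moreover have "(\<lambda>k. 2 - 2 * A (Suc k)) \<longlonglongrightarrow> 2 - 2 * l"
    by (intro tendsto_intros LIMSEQ_Suc l(2))
  ultimately show ?thesis using Lp \<open>l = 1\<close> by (simp add: is_NLFS_iff)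
qed

end

end

theorem theorem6p4:
  shows "(\<forall>(F :: int \<Rightarrow> complex) p.
            (\<lambda>n. (cmod (F n))\<^sup>2) summable_on UNIV \<and> (\<forall>n<0. F n = 0) \<and> is_NLFS F p
            \<longrightarrow> ls_seq p = (\<lambda>n. F (int n)) \<and> in_H p)
       \<and> (\<forall>p. in_H p \<longrightarrow>
            summable (\<lambda>n. (cmod (ls_seq p n))\<^sup>2) \<and>
            is_NLFS (\<lambda>k. if k < 0 then 0 else ls_seq p (nat k)) p)"
proof (intro conjI allI impI)
  fix F :: "int \<Rightarrow> complex" and p
  assume "(\<lambda>n. (cmod (F n))\<^sup>2) summable_on UNIV \<and> (\<forall>n<0. F n = 0) \<and> is_NLFS F p"
  then show "ls_seq p = (\<lambda>n. F (int n))" "in_H p"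
    using ls_seq_NLFS in_H_NLFS by blast+
next
  fix p assume p: "in_H p"
  then have H: "in_Hbar p" by (simp add: in_H_def)
  show "summable (\<lambda>n. (cmod (ls_seq p n))\<^sup>2)" by (rule summable_ls_seq[OF H])
  show "is_NLFS (\<lambda>k. if k < 0 then 0 else ls_seq p (nat k)) p"
    by (rule is_NLFS_ls_seq[OF H _ p]) simp
qed

end
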